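(* Let $G$ be a finite simple connected graph with maximum degree at most $4$ such that $G$ is not isomorphic to $C_{2,5}$. Then $\nu_s(G)\geq \frac{1}{9}n(G)$, where $n(G)$ is the number of vertices of $G$.
   Context: An induced matching of a graph $G=(V,E)$ is a set $M\subseteq E$ of edges such that every vertex of $G$ is incident to at most one edge of $M$ and, whenever $ab,cd\in M$ are distinct, none of $ac,ad,bc,bd$ belongs to $E$. The strong matching number $\nu_s(G)$ is the maximum size of an induced matching of $G$. The graph $C_{2,5}$ is obtained from the $5$-cycle $C_5$ by replacing each vertex by two non-adjacent vertices: its vertex set is $\{(i,j): i\in \mathbb{Z}_5,\ j\in\{1,2\}\}$, and $(i,j)$ is adjacent to $(i',j')$ if and only if $i'-i\equiv \pm 1 \pmod 5$. (It is $4$-regular on $10$ vertices.)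
   Formalization: The formal theorem additionally assumes that G has at least two vertices; the claim fails for the one-vertex graph, which is connected with maximum degree 0 but has strong matching number 0 < 1/9. *)

theory Defs
  imports Complex_Main "HOL-Number_Theory.Cong"
begin

text \<open>
  A graph is given by a vertex set \<open>V\<close> and a set \<open>E\<close> of edges, each edge being the two-element
  set of its endpoints; thus \<open>u\<close> and \<open>v\<close> are adjacent iff \<open>{u, v} \<in> E\<close>.
\<close>

definition finite_simple_graph :: "'a set \<Rightarrow> 'a set set \<Rightarrow> bool" where
  "finite_simple_graph V E \<longleftrightarrow> finite V \<and> (\<forall>e\<in>E. e \<subseteq> V \<and> card e = 2)"

definition degree :: "'a set set \<Rightarrow> 'a \<Rightarrow> nat" where
  "degree E v = card {e \<in> E. v \<in> e}"

text \<open>Only meaningful for finite nonempty \<open>V\<close>.\<close>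

definition max_degree :: "'a set \<Rightarrow> 'a set set \<Rightarrow> nat" where
  "max_degree V E = Max (degree E ` V)"

definition connected_graph :: "'a set \<Rightarrow> 'a set set \<Rightarrow> bool" where
  "connected_graph V E \<longleftrightarrow> V \<noteq> {} \<and> (\<forall>u\<in>V. \<forall>v\<in>V. (u, v) \<in> {(x, y). {x, y} \<in> E}\<^sup>*)"

definition graph_isomorphic :: "'a set \<Rightarrow> 'a set set \<Rightarrow> 'b set \<Rightarrow> 'b set set \<Rightarrow> bool" where
  "graph_isomorphic V E V' E' \<longleftrightarrow>
     (\<exists>f. bij_betw f V V' \<and> (\<forall>u\<in>V. \<forall>v\<in>V. {u, v} \<in> E \<longleftrightarrow> {f u, f v} \<in> E'))"

definition induced_matching :: "'a set \<Rightarrow> 'a set set \<Rightarrow> 'a set set \<Rightarrow> bool" where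
  "induced_matching V E M \<longleftrightarrow>
     M \<subseteq> E \<and>
     (\<forall>v\<in>V. card {e \<in> M. v \<in> e} \<le> 1) \<and>
     (\<forall>a b c d. {a, b} \<in> M \<and> {c, d} \<in> M \<and> {a, b} \<noteq> {c, d} \<longrightarrow>
        {a, c} \<notin> E \<and> {a, d} \<notin> E \<and> {b, c} \<notin> E \<and> {b, d} \<notin> E)"

definition strong_matching_number :: "'a set \<Rightarrow> 'a set set \<Rightarrow> nat" where
  "strong_matching_number V E = Max (card ` {M. induced_matching V E M})"

text \<open>The blown-up 5-cycle; \<open>\<int>\<^sub>5\<close> is represented by the residues \<open>0, \<dots>, 4\<close>.\<close>

definition C25_verts :: "(int \<times> nat) set" where
  "C25_verts = {0..<5} \<times> {1, 2}"

definition C25_edges :: "(int \<times> nat) set set" where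
  "C25_edges = {{(i, j), (i', j')} | i j i' j'.
     (i, j) \<in> C25_verts \<and> (i', j') \<in> C25_verts \<and>
     ([i' - i = 1] (mod 5) \<or> [i' - i = -1] (mod 5))}"

end

theory Submission imports Defs
begin

text \<open>
  For an edge \<open>xy\<close> of an induced subgraph, delete \<open>N x \<union> N y\<close> together with the set \<open>iso x y\<close> of
  vertices that become isolated. If at most 9 vertices disappear, induct on the rest. So suppose
  that every edge is bad, that is, \<open>|N x \<union> N y| + |iso x y| \<ge> 10\<close>. Since \<open>|N x \<union> N y| \<le> 8\<close> and every
  vertex of \<open>iso x y\<close> sends all its edges to the at most 6 vertices of \<open>N x \<union> N y - {x, y}\<close>, counting
  those edges near a vertex of minimum degree rules out the minimum degrees 1, 2 and 3 in turn.
  In the remaining 4-regular case the graph is triangle-free, no two vertices have exactly three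
  common neighbours, any two vertices of \<open>iso x y\<close> are twins, and the component of \<open>xy\<close> is
  \<open>C\<^sub>2\<^sub>,\<^sub>5\<close>. Having all degrees 4, such a component is also a component of the whole graph, which is
  impossible.
\<close>

text \<open>In C_{2,5} every edge has \<open>|N x \<union> N y| = 8\<close> and
  \<open>|iso x y| = 2\<close>, so that graph meets the threshold 10 exactly, and the last case has
  to determine a graph rather than refute it. Put \<open>U = N x \<union> N y\<close> and let
  \<open>t\<close> be the number of common neighbours. For minimum degree \<open>k\<close> the edge
  count reads \<open>10 * k + 6 + t \<le> (k + 3) * |U|\<close>. It is too weak for
  \<open>k = 1\<close>; it forces \<open>|U| \<ge> 6\<close> for \<open>k = 2\<close> and
  \<open>k = 3\<close>, and \<open>|U| \<ge> 7\<close> for \<open>k = 4\<close>. Leaves therefore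
  need a weighted count of their own. Elsewhere the typical contradiction is a set of at most nine
  vertices that contains \<open>N x\<close>, \<open>N y\<close> and \<open>iso x y\<close> for some
  edge (\<open>bad_subset\<close>). Deleting vertices destroys connectedness, so the induction
  bounds only the number of non-isolated vertices, and connectedness of the whole graph enters only
  after a copy of C_{2,5} has been found in some induced subgraph.\<close>

lemma sum_indicator_eq_card:
  "finite A \<Longrightarrow> (\<Sum>x\<in>A. if P x then 1 else 0 :: nat) = card {x \<in> A. P x}"
  by (simp flip: sum.inter_filter)

lemma card_3_memE:
  assumes "card A = 3" "a \<in> A"
  obtains b c where "A = {a, b, c}" "a \<noteq> b" "a \<noteq> c" "b \<noteq> c"
proof -
  have "card (A - {a}) = 2" using assms by (simp add: card_Diff_singleton)
  then obtain b c where bc: "A - {a} = {b, c}" "b \<noteq> c" by (auto simp: card_2_iff)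
  then have "A = {a, b, c}" "a \<noteq> b" "a \<noteq> c" using assms(2) by auto
  with bc(2) show ?thesis using that by blast
qed

lemma sum_eq_boundD:
  fixes f :: "'a \<Rightarrow> nat"
  assumes "finite A" "x \<in> A" "k * card A \<le> sum f A" "\<And>x. x \<in> A \<Longrightarrow> f x \<le> k"
  shows "f x = k"
proof -
  have "sum f A = f x + sum f (A - {x})" using assms by (simp add: sum.remove)
  moreover have "sum f (A - {x}) \<le> of_nat (card (A - {x})) * k"
    using assms(4) by (intro sum_bounded_above) auto
  moreover have "card A = Suc (card (A - {x}))" using assms by (metis card_Suc_Diff1)
  ultimately have "k \<le> f x" using assms(3) by (simp add: mult.commute)
  then show ?thesis using assms(2,4) by (simp add: le_antisym)
qed

lemma two_subsets_of_3:
  assumes "card Z = 3" "X \<subseteq> Z" "Y \<subseteq> Z" "card X = 2" "card Y = 2" "X \<noteq> Y"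
  obtains b c d where "X = {b, c}" "Y = {c, d}" "Z = {b, c, d}" "b \<noteq> c" "b \<noteq> d" "c \<noteq> d"
proof -
  have fin: "finite Z" using assms(1) card.infinite by fastforce
  have "card (Z - X) = 1" "card (Z - Y) = 1"
    using assms fin by (simp_all add: card_Diff_subset finite_subset)
  then obtain d b where d: "Z - X = {d}" "Z - Y = {b}" by (auto simp: card_1_singleton_iff)
  then have "d \<in> Z" "b \<in> Z" "d \<noteq> b" using assms by blast+
  from card_3_memE[OF assms(1) \<open>b \<in> Z\<close>] obtain p q where
    Z: "Z = {b, p, q}" "b \<noteq> p" "b \<noteq> q" "p \<noteq> q" by blast
  define c where "c = (if p = d then q else p)"
  have Z': "Z = {b, c, d}" "b \<noteq> c" "c \<noteq> d" using Z \<open>d \<in> Z\<close> \<open>d \<noteq> b\<close> unfolding c_def by auto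
  have "X = Z - {d}" "Y = Z - {b}" using d assms(2,3) by blast+
  then have "X = {b, c}" "Y = {c, d}" using Z' \<open>d \<noteq> b\<close> by auto
  then show ?thesis using that Z' \<open>d \<noteq> b\<close> by blast
qed

text \<open>There is no vertex set: isolated vertices, deleted vertices and points outside the graph
  all have \<open>N x = {}\<close>. The condition \<open>N z \<noteq> {}\<close> in
  \<open>iso\<close> thus keeps only vertices that had an edge before the deletion.\<close>

locale subquartic =
  fixes N :: "'a \<Rightarrow> 'a set"
  assumes nsym: "x \<in> N y \<Longrightarrow> y \<in> N x"
    and nirr: "x \<notin> N x"
    and nfin: "finite (N x)"
    and ncard: "card (N x) \<le> 4"
begin

lemma nsym_iff: "x \<in> N y \<longleftrightarrow> y \<in> N x"
  using nsym by blast

text \<open>For adjacent \<open>x\<close> and \<open>y\<close>, the set \<open>N x \<union> N y\<close> contains \<open>x\<close> and \<open>y\<close> themselves.\<close>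

definition iso :: "'a \<Rightarrow> 'a \<Rightarrow> 'a set" where
  "iso x y = {z. N z \<noteq> {} \<and> z \<notin> N x \<union> N y \<and> N z \<subseteq> N x \<union> N y}"

lemma isoD:
  assumes "z \<in> iso x y" "y \<in> N x"
  shows "N z \<subseteq> N x \<union> N y - {x, y}" "z \<notin> N x" "z \<notin> N y" "N z \<noteq> {}" "z \<noteq> x" "z \<noteq> y"
  using assms nsym unfolding iso_def by blast+

lemma finite_iso: "finite (iso x y)"
proof (rule finite_subset)
  show "iso x y \<subseteq> (\<Union>v\<in>N x \<union> N y. N v)"
    unfolding iso_def using nsym by blast
  show "finite (\<Union>v\<in>N x \<union> N y. N v)" using nfin by blast
qed

lemma card_diff_nbr: "y \<in> N x \<Longrightarrow> card (N x - {y}) \<le> 3"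
  using ncard[of x] nfin[of x] by (simp add: card_Diff_singleton)

lemma double_count:
  assumes "finite A" "finite B"
  shows "(\<Sum>z\<in>A. card (N z \<inter> B)) = (\<Sum>y\<in>B. card (N y \<inter> A))"
proof -
  have "(\<Sum>z\<in>A. card (N z \<inter> B)) = (\<Sum>z\<in>A. \<Sum>y\<in>B. if y \<in> N z then 1 else 0)"
    using assms by (simp add: sum.If_cases Int_commute)
  also have "\<dots> = (\<Sum>y\<in>B. \<Sum>z\<in>A. if z \<in> N y then 1 else 0)"
    by (subst sum.swap) (simp add: nsym_iff)
  also have "\<dots> = (\<Sum>y\<in>B. card (N y \<inter> A))"
    using assms by (simp add: sum.If_cases Int_commute)
  finally show ?thesis .
qed

end

section \<open>Graphs in which every edge is bad\<close>

locale all_edges_bad = subquartic +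
  assumes bad: "y \<in> N x \<Longrightarrow> 10 \<le> card (N x \<union> N y) + card (iso x y)"
begin

text \<open>Counts the edges between \<open>iso x y\<close> and \<open>N x \<union> N y - {x, y}\<close> from both sides.\<close>

lemma min_degree_bound:
  assumes xy: "y \<in> N x" and min: "\<And>z. N z \<noteq> {} \<Longrightarrow> k \<le> card (N z)"
  shows "10 * k + 6 + card (N x \<inter> N y) \<le> (k + 3) * card (N x \<union> N y)"
proof -
  define Y where "Y = N x \<union> N y - {x, y}"
  have yx: "x \<in> N y" using xy nsym by blast
  have finY: "finite Y" unfolding Y_def using nfin by blast
  have "{x, y} \<subseteq> N x \<union> N y" "x \<noteq> y" using xy yx nirr by auto
  then have cY: "card (N x \<union> N y) = card Y + 2"
    unfolding Y_def using nfin card_mono[of "N x \<union> N y" "{x, y}"] by (subst card_Diff_subset) auto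
  have "k * card (iso x y) \<le> (\<Sum>z\<in>iso x y. card (N z \<inter> Y))"
  proof -
    have "k \<le> card (N z \<inter> Y)" if "z \<in> iso x y" for z
      using isoD[OF that xy] min[of z] by (simp add: Y_def Int_absorb2)
    from sum_bounded_below[of "iso x y" k, OF this] show ?thesis by (simp add: mult.commute)
  qed
  also have "\<dots> = (\<Sum>v\<in>Y. card (N v \<inter> iso x y))"
    by (rule double_count[OF finite_iso finY])
  finally have 1: "k * card (iso x y) \<le> (\<Sum>v\<in>Y. card (N v \<inter> iso x y))" .
  \<comment> \<open>Of the at most four edges at \<open>v\<close>, one goes to \<open>x\<close> or
    \<open>y\<close>, and two do if \<open>v\<close> is a common neighbour. The indicator records
    this second loss.\<close>
  have "(\<Sum>v\<in>Y. card (N v \<inter> iso x y) + (if v \<in> N x \<inter> N y then 1 else 0)) \<le> (\<Sum>v\<in>Y. 3)"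
  proof (rule sum_mono)
    fix v assume v: "v \<in> Y"
    have sub: "N v \<inter> iso x y \<subseteq> N v - {x, y}"
      unfolding iso_def using xy yx by blast
    show "card (N v \<inter> iso x y) + (if v \<in> N x \<inter> N y then 1 else 0) \<le> 3"
    proof (cases "v \<in> N x \<inter> N y")
      case True
      then have "{x, y} \<subseteq> N v" using nsym by blast
      then have "card (N v - {x, y}) = card (N v) - 2"
        using \<open>x \<noteq> y\<close> by (simp add: card_Diff_subset)
      then show ?thesis using True card_mono[OF _ sub] nfin ncard[of v] by simp
    next
      case False
      have "card (N v - {x, y}) \<le> 3"
      proof (cases "x \<in> N v")
        case True
        then show ?thesis using card_diff_nbr[OF True] card_mono[of "N v - {x}" "N v - {x, y}"] nfin by fastforce
      next
        case F: False
        then have "y \<in> N v" using v nsym unfolding Y_def by blast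
        then show ?thesis using card_diff_nbr[of y v] card_mono[of "N v - {y}" "N v - {x, y}"] nfin by fastforce
      qed
      then have "card (N v \<inter> iso x y) \<le> 3" using card_mono[OF _ sub] nfin[of v] by simp
      then show ?thesis using False by (simp only: if_False)
    qed
  qed
  moreover have "(\<Sum>v\<in>Y. if v \<in> N x \<inter> N y then 1 else 0) = card (N x \<inter> N y)"
  proof -
    have "Y \<inter> {v. v \<in> N x \<and> v \<in> N y} = N x \<inter> N y" using nirr by (auto simp: Y_def)
    then show ?thesis using finY by (simp add: sum.If_cases)
  qed
  ultimately have 2: "(\<Sum>v\<in>Y. card (N v \<inter> iso x y)) + card (N x \<inter> N y) \<le> 3 * card Y"
    by (simp add: sum.distrib)
  have "k * 10 \<le> k * (card (N x \<union> N y) + card (iso x y))"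
    using bad[OF xy] by (rule mult_le_mono2)
  then show ?thesis using 1 2 cY by (simp add: algebra_simps)
qed

subsection \<open>Minimum degree 1\<close>

text \<open>A leaf contributes only \<open>a\<close> to \<open>N w \<union> N a\<close>, which then
  has at most five elements; badness must be made up by \<open>iso w a\<close>, all of it attached
  to the at most three other neighbours of \<open>a\<close>.\<close>

lemma leaf_iso:
  assumes "N w = {a}"
  shows "9 \<le> card (N a) + card (iso w a)" "5 \<le> card (iso w a)"
    and "z \<in> iso w a \<Longrightarrow> N z \<subseteq> N a - {w}"
proof -
  have "a \<in> N w" using assms by simp
  moreover have "N w \<union> N a = insert a (N a)" using assms by auto
  ultimately show 1: "9 \<le> card (N a) + card (iso w a)"
    using bad[of a w] nirr[of a] nfin[of a] by simp
  then show "5 \<le> card (iso w a)" using ncard[of a] by simp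
  show "z \<in> iso w a \<Longrightarrow> N z \<subseteq> N a - {w}"
    using isoD(1)[of z w a] assms by auto
qed

text \<open>The leaf \<open>z\<close> makes \<open>iso z y\<close> large by \<open>leaf_iso\<close>.
  But a vertex of \<open>iso z y\<close> is adjacent to \<open>a\<close> or to a vertex of
  \<open>iso w a\<close>, and either way it lies in \<open>N a - {y}\<close>, which is too
  small.\<close>

lemma leaf_absorbing_nbr_False:
  assumes w: "N w = {a}" and y: "y \<in> N a" and z: "N z = {y}" and sub: "N y - {a} \<subseteq> iso w a"
  shows False
proof -
  have "iso z y \<subseteq> N a - {y}"
  proof
    fix t assume t: "t \<in> iso z y"
    have "y \<in> N z" using z by simp
    note tD = isoD[OF t this]
    obtain s where s: "s \<in> N t" using tD by blast
    then have sy: "s \<in> N y" using tD z by auto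
    have "t \<in> N a"
    proof (cases "s = a")
      case True then show ?thesis using s nsym by blast
    next
      case False
      then have "N s \<subseteq> N a - {w}" using sub sy leaf_iso(3)[OF w] by blast
      then show ?thesis using s nsym by blast
    qed
    then show "t \<in> N a - {y}" using tD by blast
  qed
  then have "card (iso z y) \<le> card (N a - {y})" using nfin by (intro card_mono) auto
  then show False using leaf_iso(2)[OF z] card_diff_nbr[OF y] by linarith
qed

text \<open>At least five vertices hang on the non-leaf neighbours \<open>Q\<close> of
  \<open>a\<close>, each offering at most three edges. If \<open>card Q \<le> 2\<close>, one of them
  spends all three on \<open>iso w a\<close> and reaches a leaf there, contradicting
  \<open>leaf_absorbing_nbr_False\<close>. Thus \<open>w\<close> is the only leaf at
  \<open>a\<close>.\<close>

lemma leaf_nbr: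
  assumes w: "N w = {a}"
  shows "card (N a - {w}) = 3" "\<And>y. y \<in> N a - {w} \<Longrightarrow> N y \<noteq> {a}"
proof -
  define Q where "Q = {y \<in> N a. N y \<noteq> {a}}"
  have wa: "w \<in> N a" using w nsym by blast
  have QN: "Q \<subseteq> N a - {w}" using w unfolding Q_def by auto
  have NQ: "N z \<subseteq> Q" if "z \<in> iso w a" for z
    using leaf_iso(3)[OF w that] isoD[OF that] w nsym unfolding Q_def by blast
  \<comment> \<open>The small overlap with \<open>N y2\<close> leaves a vertex of
    \<open>iso w a\<close> whose only neighbour is \<open>y1\<close>.\<close>
  have key: False if Qs: "Q \<subseteq> {y1, y2}" and y1: "y1 \<in> N a"
    and c: "card ((N y1 - {a}) \<inter> iso w a) = 3"
    and o: "card ((N y1 - {a}) \<inter> iso w a \<inter> N y2) \<le> 1" for y1 y2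
  proof -
    let ?B = "N y1 - {a}"
    have "card ?B \<le> 3" using y1 nsym card_diff_nbr by blast
    then have "?B \<inter> iso w a = ?B" using c nfin by (intro card_seteq) auto
    then have sub: "?B \<subseteq> iso w a" by blast
    have "\<not> ?B \<inter> iso w a \<subseteq> N y2"
    proof
      assume "?B \<inter> iso w a \<subseteq> N y2"
      then have "?B \<inter> iso w a \<inter> N y2 = ?B \<inter> iso w a" by blast
      then show False using c o by simp
    qed
    then obtain z where z: "z \<in> ?B" "z \<in> iso w a" "z \<notin> N y2" by blast
    then have "N z \<subseteq> {y1}" using NQ[OF z(2)] Qs nsym by blast
    then have "N z = {y1}" using z nsym by blast
    then show False using leaf_absorbing_nbr_False[OF w y1 _ sub] by blast
  qed
  have "3 \<le> card Q"
  proof (rule ccontr)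
    assume "\<not> 3 \<le> card Q"
    have finQ: "finite Q" unfolding Q_def using nfin by simp
    have "\<exists>y1\<in>N a. \<exists>y2\<in>N a. Q \<subseteq> {y1, y2}"
    proof -
      consider "card Q = 0" | "card Q = 1" | "card Q = 2" using \<open>\<not> 3 \<le> card Q\<close> by linarith
      then show ?thesis
      proof cases
        case 1 then show ?thesis using finQ wa by auto
      next
        case 2 then obtain y where "Q = {y}" by (auto simp: card_1_singleton_iff)
        then show ?thesis using QN by blast
      next
        case 3 then obtain y y' where "Q = {y, y'}" by (auto simp: card_2_iff)
        then show ?thesis using QN by blast
      qed
    qed
    then obtain y1 y2 where y: "y1 \<in> N a" "y2 \<in> N a" "Q \<subseteq> {y1, y2}" by blast
    let ?B1 = "(N y1 - {a}) \<inter> iso w a" and ?B2 = "(N y2 - {a}) \<inter> iso w a"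
    have fin: "finite ?B1" "finite ?B2" using nfin by auto
    have I: "iso w a = ?B1 \<union> ?B2"
    proof
      show "iso w a \<subseteq> ?B1 \<union> ?B2"
      proof
        fix z assume z: "z \<in> iso w a"
        have "z \<noteq> a" using isoD(6)[OF z] w by simp
        moreover have "N z \<noteq> {}" "N z \<subseteq> {y1, y2}" using NQ[OF z] y z unfolding iso_def by auto
        ultimately show "z \<in> ?B1 \<union> ?B2" using z nsym by blast
      qed
    qed auto
    have "card ?B1 \<le> card (N y1 - {a})" "card ?B2 \<le> card (N y2 - {a})"
      using nfin by (auto intro: card_mono)
    then have le: "card ?B1 \<le> 3" "card ?B2 \<le> 3"
      using card_diff_nbr nsym y by (meson le_trans)+
    have eq: "card ?B1 + card ?B2 = card (iso w a) + card (?B1 \<inter> ?B2)"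
      using card_Un_Int[OF fin] I by simp
    have o: "?B1 \<inter> N y2 = ?B1 \<inter> ?B2" "?B2 \<inter> N y1 = ?B1 \<inter> ?B2" by auto
    have five: "5 \<le> card (iso w a)" using leaf_iso(2)[OF w] .
    \<comment> \<open>Two sets of size at most 3 cover at least five vertices, so they overlap in at
      most one and one of them has size 3; \<open>key\<close> applies to that one.\<close>
    show False
    proof (cases "card ?B1 = 3")
      case True
      then show False using key[of y1 y2] y o eq le five by auto
    next
      case False
      then show False using key[of y2 y1] y o eq le five by auto
    qed
  qed
  moreover have "card (N a - {w}) \<le> 3" by (rule card_diff_nbr[OF wa])
  ultimately have "Q = N a - {w}" "card (N a - {w}) = 3"
    using QN card_mono[OF _ QN] nfin card_seteq[OF _ QN] by auto
  then show "card (N a - {w}) = 3" "\<And>y. y \<in> N a - {w} \<Longrightarrow> N y \<noteq> {a}"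
    unfolding Q_def by auto
qed

definition has_leaf :: "'a \<Rightarrow> nat" where
  "has_leaf y = (if \<exists>z. N z = {y} then 1 else 0)"

text \<open>A vertex of \<open>iso w a\<close> has two neighbours or is a leaf. An extra unit for
  leaves makes each of the at least five vertices count twice. By \<open>leaf_nbr\<close> a vertex
  carries at most one leaf, so the extra units can be charged to the \<open>y\<close> through
  \<open>has_leaf\<close>.\<close>

lemma leaf_slots:
  assumes w: "N w = {a}"
  shows "10 \<le> (\<Sum>y\<in>N a - {w}. card (N y \<inter> iso w a) + has_leaf y)"
proof -
  let ?I = "iso w a" and ?Y = "N a - {w}"
  let ?L = "{z \<in> ?I. \<exists>y. N z = {y}}" and ?H = "{y \<in> ?Y. \<exists>z. N z = {y}}"
  have finY: "finite ?Y" using nfin by simp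
  have uniq: "z = z'" if "N z = {y}" "N z' = {y}" for z z' y
    using leaf_nbr(2)[OF that(1), of z'] that nsym by blast
  have "?L \<subseteq> (\<lambda>y. THE z. N z = {y}) ` ?H"
  proof
    fix z assume "z \<in> ?L"
    then obtain y where y: "z \<in> ?I" "N z = {y}" by blast
    then have "y \<in> ?H" using leaf_iso(3)[OF w y(1)] by blast
    moreover have "(THE z. N z = {y}) = z" using y uniq by (intro the_equality)
    ultimately show "z \<in> (\<lambda>y. THE z. N z = {y}) ` ?H" by (intro image_eqI) auto
  qed
  then have "card ?L \<le> card ?H" by (rule surj_card_le[rotated]) (rule finite_subset[OF _ nfin[of a]], blast)
  moreover have "(\<Sum>y\<in>?Y. has_leaf y) = card ?H"
    unfolding has_leaf_def by (rule sum_indicator_eq_card[OF finY])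
  ultimately have 1: "card ?L \<le> (\<Sum>y\<in>?Y. has_leaf y)" by simp
  have "(\<Sum>z\<in>?I. 2) \<le> (\<Sum>z\<in>?I. card (N z \<inter> ?Y) + (if \<exists>y. N z = {y} then 1 else 0))"
  proof (rule sum_mono)
    fix z assume z: "z \<in> ?I"
    have "N z \<inter> ?Y = N z" using leaf_iso(3)[OF w z] by blast
    moreover have "card (N z) \<noteq> 0" using z nfin unfolding iso_def by simp
    moreover have "\<exists>y. N z = {y}" if "card (N z) = 1" using that by (simp add: card_1_singleton_iff)
    ultimately show "2 \<le> card (N z \<inter> ?Y) + (if \<exists>y. N z = {y} then 1 else 0)"
      by (cases "card (N z) = 1") auto
  qed
  also have "\<dots> = (\<Sum>z\<in>?I. card (N z \<inter> ?Y)) + card ?L"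
    unfolding sum.distrib by (simp only: sum_indicator_eq_card[OF finite_iso])
  also have "(\<Sum>z\<in>?I. card (N z \<inter> ?Y)) = (\<Sum>y\<in>?Y. card (N y \<inter> ?I))"
    by (rule double_count[OF finite_iso finY])
  finally show ?thesis using 1 leaf_iso(2)[OF w] by (simp add: sum.distrib)
qed

text \<open>Each of the three \<open>y\<close> supplies at most 3 + 1 of the ten units, so some
  \<open>y1\<close> carries a leaf \<open>z\<close>. The same count around \<open>y1\<close> is then
  tight, which starves \<open>y1\<close> in the first count until \<open>y2\<close> is full and
  carries a leaf, against \<open>leaf_absorbing_nbr_False\<close>.\<close>

lemma no_leaf: "N w \<noteq> {a}"
proof
  assume w: "N w = {a}"
  let ?I = "iso w a"
  have aI: "a \<notin> ?I" using w isoD(6)[of a w a] by blast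
  have le3: "card (N y \<inter> ?I) \<le> 3" if "y \<in> N a" for y
  proof -
    have "N y \<inter> ?I \<subseteq> N y - {a}" using aI by blast
    then have "card (N y \<inter> ?I) \<le> card (N y - {a})" using nfin by (intro card_mono) auto
    also have "\<dots> \<le> 3" using that nsym card_diff_nbr by blast
    finally show ?thesis .
  qed
  have full: "N y - {a} \<subseteq> ?I" if "y \<in> N a" "card (N y \<inter> ?I) = 3" for y
  proof -
    have "N y \<inter> ?I \<subseteq> N y - {a}" using aI by blast
    then have "N y \<inter> ?I = N y - {a}"
      using that card_diff_nbr[of a y] nsym nfin by (intro card_seteq) auto
    then show ?thesis by blast
  qed
  have hl: "has_leaf y \<le> 1" for y by (simp add: has_leaf_def)
  have aux: False
    if Y: "N a - {w} = {y1, y2, y3}" and d: "y1 \<noteq> y2" "y1 \<noteq> y3" "y2 \<noteq> y3" and z: "N z = {y1}"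
    for y1 y2 y3 z
  proof -
    let ?J = "iso z y1"
    have wa: "w \<in> N a" using w nsym by blast
    have Na: "N a = {w, y1, y2, y3}" using Y wa by blast
    have y: "y1 \<in> N a" "y2 \<in> N a" "y3 \<in> N a" using Na by auto
    have slots: "10 \<le> card (N y1 \<inter> ?I) + has_leaf y1 + (card (N y2 \<inter> ?I) + has_leaf y2)
        + (card (N y3 \<inter> ?I) + has_leaf y3)"
      using leaf_slots[OF w] d unfolding Y by simp
    have "y2 \<notin> N z" using z d by simp
    then have "a \<noteq> z" using y(2) by blast
    then have "a \<in> N y1 - {z}" using nsym[OF y(1)] by blast
    with leaf_nbr(1)[OF z]
    obtain c1 c2 where c: "N y1 - {z} = {a, c1, c2}" "a \<noteq> c1" "a \<noteq> c2" "c1 \<noteq> c2"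
      by (rule card_3_memE)
    have zy: "y1 \<in> N z" using z by simp
    have slots': "10 \<le> card (N a \<inter> ?J) + has_leaf a + (card (N c1 \<inter> ?J) + has_leaf c1)
        + (card (N c2 \<inter> ?J) + has_leaf c2)"
      using leaf_slots[OF z] c unfolding c(1) by simp
    \<comment> \<open>If \<open>y \<in> ?J\<close>, all neighbours of \<open>y\<close> are adjacent
      to \<open>y1\<close>, so \<open>y\<close> carries no leaf and sends at most two edges to
      \<open>?I\<close>. Of the ten units, 10 - 2 - 4 = 4 fall to \<open>y1\<close>, which makes it
      absorbing.\<close>
    have nJ: "y \<notin> ?J" if yy: "y = y2 \<and> y' = y3 \<or> y = y3 \<and> y' = y2" for y y'
    proof
      assume yJ: "y \<in> ?J"
      have Ny: "N y \<subseteq> {a, c1, c2}" using leaf_iso(3)[OF z yJ] c(1) by simp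
      have "y \<noteq> y1" using yy d by auto
      have "\<not> (\<exists>x. N x = {y})"
      proof
        assume "\<exists>x. N x = {y}"
        then obtain x where x: "N x = {y}" by blast
        then have "x \<in> {a, c1, c2}" using Ny nsym by blast
        moreover have "y1 \<in> N v" if "v \<in> {a, c1, c2}" for v using that c(1) nsym by blast
        ultimately have "y1 \<in> N x" by blast
        then show False using x \<open>y \<noteq> y1\<close> by simp
      qed
      then have "has_leaf y = 0" by (simp add: has_leaf_def)
      moreover have "N y \<inter> ?I \<subseteq> {c1, c2}" using Ny aI by blast
      then have "card (N y \<inter> ?I) \<le> 2" using card_mono[of "{c1, c2}" "N y \<inter> ?I"] c by simp
      moreover have "card (N y' \<inter> ?I) \<le> 3" using le3 yy y by blast
      ultimately have "card (N y1 \<inter> ?I) = 3"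
        using slots yy le3[OF y(1)] hl[of y1] hl[of y'] by auto
      then show False using leaf_absorbing_nbr_False[OF w y(1) z full[OF y(1)]] by blast
    qed
    have "y2 \<notin> ?J" "y3 \<notin> ?J" using nJ by blast+
    then have "N a \<inter> ?J \<subseteq> {w}" using Na isoD(6)[OF _ zy] by blast
    then have 1: "card (N a \<inter> ?J) \<le> 1" using card_mono[of "{w}" "N a \<inter> ?J"] by simp
    have leJ: "card (N v \<inter> ?J) \<le> 3" if "v \<in> N y1" for v
    proof -
      have "N v \<inter> ?J \<subseteq> N v - {y1}" using isoD(6)[OF _ zy] by blast
      then have "card (N v \<inter> ?J) \<le> card (N v - {y1})" using nfin by (intro card_mono) auto
      also have "\<dots> \<le> 3" using that nsym card_diff_nbr by blast
      finally show ?thesis .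
    qed
    have "c1 \<in> N y1" "c2 \<in> N y1" using c(1) by auto
    \<comment> \<open>The upper bounds 2 + 4 + 4 only just reach the ten of
      \<open>slots'\<close>.\<close>
    then have hlc: "has_leaf c1 = 1" "has_leaf c2 = 1"
      using slots' 1 leJ[of c1] leJ[of c2] hl[of a] hl[of c1] hl[of c2] by linarith+
    have cI: "v \<notin> ?I" if "has_leaf v = 1" for v
    proof
      assume v: "v \<in> ?I"
      obtain x where x: "N x = {v}" using \<open>has_leaf v = 1\<close> unfolding has_leaf_def by (auto split: if_splits)
      then have "x \<in> N a" using leaf_iso(3)[OF w v] nsym by blast
      then have "a = v" using x nsym by blast
      then show False using v aI by blast
    qed
    have "N y1 \<subseteq> {z, a, c1, c2}" using equalityD1[OF c(1)] by blast
    then have "N y1 \<inter> ?I \<subseteq> {z}" using cI[OF hlc(1)] cI[OF hlc(2)] aI by blast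
    then have "card (N y1 \<inter> ?I) \<le> 1" using card_mono[of "{z}" "N y1 \<inter> ?I"] by simp
    \<comment> \<open>Now \<open>y1\<close> supplies at most two units, so the count around
      \<open>a\<close> is tight in the same way.\<close>
    then have "card (N y2 \<inter> ?I) = 3" "has_leaf y2 = 1"
      using slots le3[OF y(2)] le3[OF y(3)] hl[of y1] hl[of y2] hl[of y3] by linarith+
    moreover then obtain x where "N x = {y2}" unfolding has_leaf_def by (auto split: if_splits)
    ultimately show False using leaf_absorbing_nbr_False[OF w y(2) _ full[OF y(2)]] by blast
  qed
  obtain y1 y2 y3 where Y: "N a - {w} = {y1, y2, y3}" and d: "y1 \<noteq> y2" "y1 \<noteq> y3" "y2 \<noteq> y3"
    using leaf_nbr(1)[OF w] by (auto simp: card_3_iff)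
  have "10 \<le> card (N y1 \<inter> ?I) + has_leaf y1 + (card (N y2 \<inter> ?I) + has_leaf y2)
      + (card (N y3 \<inter> ?I) + has_leaf y3)"
    using leaf_slots[OF w] d unfolding Y by simp
  moreover have "y1 \<in> N a" "y2 \<in> N a" "y3 \<in> N a" using Y by auto
  note this[THEN le3]
  ultimately consider "has_leaf y1 \<noteq> 0" | "has_leaf y2 \<noteq> 0" | "has_leaf y3 \<noteq> 0" by linarith
  then show False
  proof cases
    case 1
    then obtain z where "N z = {y1}" unfolding has_leaf_def by (auto split: if_splits)
    then show False using aux[OF Y d] by blast
  next
    case 2
    then obtain z where z: "N z = {y2}" unfolding has_leaf_def by (auto split: if_splits)
    have "N a - {w} = {y2, y1, y3}" using Y by blast
    from aux[OF this _ _ _ z] d show False by blast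
  next
    case 3
    then obtain z where z: "N z = {y3}" unfolding has_leaf_def by (auto split: if_splits)
    have "N a - {w} = {y3, y1, y2}" using Y by blast
    from aux[OF this _ _ _ z] d show False by blast
  qed
qed

lemma min_degree_2: "N x \<noteq> {} \<Longrightarrow> 2 \<le> card (N x)"
proof -
  assume "N x \<noteq> {}"
  then have "card (N x) \<noteq> 0" using nfin by simp
  moreover have "card (N x) \<noteq> 1" using no_leaf by (auto simp: card_1_singleton_iff)
  ultimately show ?thesis by linarith
qed

subsection \<open>Minimum degree 2\<close>

text \<open>Used to refute local structures: it suffices to enclose everything that disappears with
  one edge in a set of at most nine vertices.\<close>

lemma bad_subset:
  assumes "y \<in> N x" "N x \<union> N y \<subseteq> D" "iso x y \<subseteq> D" "finite D"
  shows "10 \<le> card D"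
proof -
  have "(N x \<union> N y) \<inter> iso x y = {}" unfolding iso_def by blast
  then have "card (N x \<union> N y) + card (iso x y) = card (N x \<union> N y \<union> iso x y)"
    using nfin finite_iso by (simp add: card_Un_disjoint)
  also have "\<dots> \<le> card D" using assms by (intro card_mono) auto
  finally show ?thesis using bad[OF assms(1)] by linarith
qed

text \<open>The count gives \<open>card (N a) = 4\<close>, \<open>b \<notin> N a\<close> and at
  least four vertices in \<open>iso w a\<close>. What obstructs a purely local argument at
  \<open>a\<close> are those of them adjacent to \<open>b\<close>. Once these are excluded, the four
  vertices depend on the three vertices of \<open>N a - {w}\<close> alone.\<close>

lemma no_degree_2: "card (N w) \<noteq> 2"
proof
  assume "card (N w) = 2"
  then obtain a0 b0 where ab0: "N w = {a0, b0}" "a0 \<noteq> b0" by (auto simp: card_2_iff)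
  \<comment> \<open>The vertices of \<open>iso w a\<close> that depend on \<open>N a - {w}\<close>
    only.\<close>
  define R where "R a b = {z \<in> iso w a. b \<notin> N z}" for a b
  have finR: "finite (R a b)" for a b unfolding R_def using finite_iso by simp
  have deg: "card (N a) = 4 \<and> b \<notin> N a" if ab: "N w = {a, b}" "a \<noteq> b" for a b
  proof -
    have aw: "a \<in> N w" using ab by simp
    have bd: "26 + card (N w \<inter> N a) \<le> 5 * card (N w \<union> N a)"
      using min_degree_bound[OF aw, of 2] min_degree_2 by simp
    have "b \<notin> N a"
    proof
      assume b: "b \<in> N a"
      then have "N w \<union> N a = insert a (N a)" "N w \<inter> N a = {b}" using ab nirr by auto
      then show False using bd ncard[of a] nfin[of a] nirr[of a] by simp
    qed
    moreover have "card (N w \<union> N a) = card (N a) + 2"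
    proof -
      have "N w \<union> N a = insert a (insert b (N a))" using ab by auto
      then show ?thesis using \<open>b \<notin> N a\<close> nirr[of a] nfin[of a] ab by simp
    qed
    ultimately show ?thesis using bd ncard[of a] by auto
  qed
  have P3: "card (N a - {w}) = 3" if "N w = {a, b}" "a \<noteq> b" for a b
  proof -
    have "w \<in> N a" using that nsym by blast
    then show ?thesis using deg[OF that] by (simp add: card_Diff_singleton)
  qed
  have isoN: "N z \<subseteq> (N a - {w}) \<union> {b}" if "N w = {a, b}" "z \<in> iso w a" for a b z
    using isoD(1)[OF that(2)] that(1) by auto
  have iso4: "4 \<le> card (iso w a)" if ab: "N w = {a, b}" "a \<noteq> b" for a b
  proof -
    have "N w \<union> N a = insert a (insert b (N a))" using ab by auto
    then have "card (N w \<union> N a) = 6" using deg[OF ab] nirr[of a] nfin[of a] ab by simp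
    then show ?thesis using bad[of a w] ab by simp
  qed
  have RN: "N r \<subseteq> N a - {w}" if "N w = {a, b}" "r \<in> R a b" for a b r
    using isoN[OF that(1)] that(2) unfolding R_def by blast
  have isoR: "iso w a \<subseteq> R a b \<union> ((N b - {w}) \<inter> iso w a)" if "N w = {a, b}" for a b
  proof
    fix z assume z: "z \<in> iso w a"
    have "a \<in> N w" using that by simp
    then have "z \<noteq> w" using isoD[OF z] by blast
    then show "z \<in> R a b \<union> ((N b - {w}) \<inter> iso w a)" using z nsym unfolding R_def by blast
  qed
  have cR: "4 \<le> card (R a b) + card ((N b - {w}) \<inter> iso w a)" if ab: "N w = {a, b}" "a \<noteq> b" for a b
  proof -
    have "card (iso w a) \<le> card (R a b \<union> ((N b - {w}) \<inter> iso w a))"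
      using isoR[OF ab(1)] finR finite_iso by (intro card_mono) auto
    also have "\<dots> \<le> card (R a b) + card ((N b - {w}) \<inter> iso w a)" by (rule card_Un_le)
    finally show ?thesis using iso4[OF ab] by linarith
  qed
  \<comment> \<open>A neighbour \<open>p\<close> of \<open>r\<close> in \<open>iso w b\<close> would
    need \<open>r \<in> N b\<close> or \<open>r = a\<close>, and both are excluded for
    \<open>r \<in> R a b\<close>.\<close>
  have RP: "N r \<subseteq> N a - {w} - iso w b" if ab: "N w = {a, b}" "a \<noteq> b" and r: "r \<in> R a b" for a b r
  proof
    fix p assume p: "p \<in> N r"
    have "p \<notin> iso w b"
    proof
      assume "p \<in> iso w b"
      moreover have "N w = {b, a}" using ab by blast
      ultimately have "N p \<subseteq> (N b - {w}) \<union> {a}" by (intro isoN)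
      then have "r \<in> N b \<or> r = a" using p nsym by blast
      moreover have "r \<notin> N b" using r nsym unfolding R_def by blast
      moreover have "a \<in> N w" using ab by simp
      then have "r \<noteq> a" using r isoD(6)[of r w a] unfolding R_def by blast
      ultimately show False by blast
    qed
    then show "p \<in> N a - {w} - iso w b" using RN[OF ab(1) r] p by blast
  qed
  have R2: "2 \<le> card (N r)" if "r \<in> R a b" for a b r
    using that unfolding R_def iso_def by (auto intro!: min_degree_2)
  \<comment> \<open>At most three of the four vertices of \<open>iso w a\<close> are neighbours of
    \<open>b\<close>, so \<open>R a b\<close> has an element, and its two neighbours in
    \<open>N a - {w}\<close> avoid \<open>iso w b\<close> by \<open>RP\<close>.\<close>
  have le1: "card ((N a - {w}) \<inter> iso w b) \<le> 1" if ab: "N w = {a, b}" "a \<noteq> b" for a b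
  proof -
    have "N w = {b, a}" using ab by blast
    then have "card ((N b - {w}) \<inter> iso w a) \<le> 3"
      using card_mono[of "N b - {w}" "(N b - {w}) \<inter> iso w a"] P3[of b a] ab nfin by auto
    then have "R a b \<noteq> {}" using cR[OF ab] by auto
    then obtain r where r: "r \<in> R a b" by blast
    have "2 \<le> card (N a - {w} - iso w b)"
      using R2[OF r] card_mono[OF _ RP[OF ab r]] nfin by auto
    moreover have "card (N a - {w}) = card ((N a - {w}) \<inter> iso w b) + card (N a - {w} - iso w b)"
      using nfin by (metis card_Int_Diff finite_Diff)
    ultimately show ?thesis using P3[OF ab] by linarith
  qed
  have none: "(N a - {w}) \<inter> iso w b = {}" if ab: "N w = {a, b}" "a \<noteq> b" for a b
  proof (rule ccontr)
    assume "(N a - {w}) \<inter> iso w b \<noteq> {}"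
    then obtain p1 where p1: "p1 \<in> N a - {w}" "p1 \<in> iso w b" by blast
    obtain p2 p3 where P: "N a - {w} = {p1, p2, p3}" "p1 \<noteq> p2" "p1 \<noteq> p3" "p2 \<noteq> p3"
      using P3[OF ab] p1(1) by (rule card_3_memE)
    have Nr: "N r = {p2, p3}" if "r \<in> R a b" for r
    proof (rule card_seteq)
      show "N r \<subseteq> {p2, p3}" using RP[OF ab that] p1(2) unfolding P(1) by blast
      show "card {p2, p3} \<le> card (N r)" using R2[OF that] P by simp
    qed simp
    have "N w = {b, a}" using ab by blast
    then have "3 \<le> card (R a b)" using cR[OF ab] le1[of b a] ab by auto
    have ap: "a \<in> N p" if "p \<in> {p2, p3}" for p
      using that P(1) nsym by blast
    have Np: "N p = insert a (R a b)" if p: "p \<in> {p2, p3}" for p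
    proof -
      have sub: "R a b \<subseteq> N p - {a}"
      proof
        fix r assume r: "r \<in> R a b"
        have "a \<in> N w" using ab by simp
        then have "r \<noteq> a" using r isoD(6)[of r w a] unfolding R_def by blast
        moreover have "p \<in> N r" using Nr[OF r] p by simp
        ultimately show "r \<in> N p - {a}" using nsym by blast
      qed
      have "R a b = N p - {a}"
        using card_diff_nbr[OF ap[OF p]] \<open>3 \<le> card (R a b)\<close> nfin
        by (intro card_seteq[OF _ sub]) auto
      then show ?thesis using ap[OF p] by blast
    qed
    have "R a b \<noteq> {}" using \<open>3 \<le> card (R a b)\<close> by auto
    then obtain r where r: "r \<in> R a b" by blast
    have rp: "r \<in> N p2" using Np[of p2] r by simp
    have "card (R a b) \<le> 3"
      using card_diff_nbr[OF ap[of p2]] Np[of p2] card_mono[of "N p2 - {a}" "R a b"] nfin r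
      by (metis Diff_insert_absorb R_def ab(1) finR insertI1 isoD(6) mem_Collect_eq)
    \<comment> \<open>Every \<open>r\<close> has neighbourhood \<open>{p2, p3}\<close>, and
      \<open>p2\<close>, \<open>p3\<close> have neighbourhood \<open>insert a (R a b)\<close>. The
      enclosing set has at most 4 + 2 + 2 = 8 elements.\<close>
    have "10 \<le> card (insert a (R a b) \<union> {p2, p3} \<union> {w, p1})"
    proof (rule bad_subset[OF rp])
      show "N p2 \<union> N r \<subseteq> insert a (R a b) \<union> {p2, p3} \<union> {w, p1}"
        using Np[of p2] Nr[OF r] by auto
      show "iso p2 r \<subseteq> insert a (R a b) \<union> {p2, p3} \<union> {w, p1}"
      proof
        fix t assume t: "t \<in> iso p2 r"
        note tD = isoD[OF t rp]
        obtain s where s: "s \<in> N t" using tD by blast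
        then have "s = a \<or> s \<in> R a b \<or> s = p2 \<or> s = p3"
          using tD(1) Np[of p2] Nr[OF r] by auto
        moreover have "t \<in> N s" using s nsym by blast
        ultimately show "t \<in> insert a (R a b) \<union> {p2, p3} \<union> {w, p1}"
          using P(1) Nr[of s] Np[of s] by auto
      qed
    qed (use finR in simp)
    moreover have "card (insert a (R a b) \<union> {p2, p3} \<union> {w, p1}) \<le> card (insert a (R a b)) + card {p2, p3} + card {w, p1}"
      by (meson card_Un_le add_le_mono1 le_trans)
    moreover have "card (insert a (R a b)) \<le> 4" using \<open>card (R a b) \<le> 3\<close>
      using finR by (simp add: card_insert_if)
    moreover have "card {p2, p3} \<le> 2" "card {w, p1} \<le> 2" by (auto simp: card_insert_if)
    ultimately show False by linarith
  qed
  define a b where "a = a0" and "b = b0"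
  have ab: "N w = {a, b}" "a \<noteq> b" using ab0 by (simp_all add: a_def b_def)
  have ba: "N w = {b, a}" "b \<noteq> a" using ab by auto
  let ?P = "N a - {w}" and ?R = "R a b"
  have R4: "4 \<le> card ?R" using cR[OF ab] none[OF ba] by simp
  have "2 * card ?R \<le> (\<Sum>r\<in>?R. card (N r \<inter> ?P))"
  proof -
    have "2 \<le> card (N r \<inter> ?P)" if "r \<in> ?R" for r
      using R2[OF that] RN[OF ab(1) that] by (simp add: Int_absorb2)
    from sum_bounded_below[of ?R 2, OF this] show ?thesis by (simp add: mult.commute)
  qed
  also have "\<dots> = (\<Sum>p\<in>?P. card (N p \<inter> ?R))"
    using finR nfin by (intro double_count) auto
  finally have cnt: "2 * card ?R \<le> (\<Sum>p\<in>?P. card (N p \<inter> ?R))" .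
  have aR: "a \<notin> ?R" using isoD(6)[of a w a] ab unfolding R_def by blast
  have le3: "card (N p \<inter> ?R) \<le> 3" if "p \<in> ?P" for p
  proof -
    have "card (N p \<inter> ?R) \<le> card (N p - {a})" using nfin aR by (intro card_mono) auto
    then show ?thesis using card_diff_nbr[of a p] that nsym by fastforce
  qed
  have "(\<Sum>p\<in>?P. card (N p \<inter> ?R)) \<le> 9"
    using sum_bounded_above[of ?P "\<lambda>p. card (N p \<inter> ?R)" 3] le3 P3[OF ab] by simp
  then have Rle: "card ?R \<le> 4" using cnt by linarith
  \<comment> \<open>Four vertices send at least eight edges into three vertices, so some vertex
    receives three.\<close>
  have "\<exists>p\<in>?P. card (N p \<inter> ?R) = 3"
  proof (rule ccontr)
    assume "\<not> ?thesis"
    then have "card (N p \<inter> ?R) \<le> 2" if "p \<in> ?P" for p using le3[OF that] that by force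
    then have "(\<Sum>p\<in>?P. card (N p \<inter> ?R)) \<le> 6"
      using sum_bounded_above[of ?P "\<lambda>p. card (N p \<inter> ?R)" 2] P3[OF ab] by simp
    then show False using cnt R4 by linarith
  qed
  then obtain p where p: "p \<in> ?P" "card (N p \<inter> ?R) = 3" by blast
  have ap: "a \<in> N p" using p nsym by blast
  have "N p \<inter> ?R = N p - {a}"
    using p(2) card_diff_nbr[OF ap] aR nfin by (intro card_seteq) auto
  then have Np: "N p \<subseteq> insert a ?R" by blast
  have "N p \<inter> ?R \<noteq> {}" using p(2) by auto
  then obtain r where r: "r \<in> N p" "r \<in> ?R" by blast
  have "10 \<le> card (insert a (?P \<union> ?R))"
  proof (rule bad_subset[OF r(1)])
    show sub: "N p \<union> N r \<subseteq> insert a (?P \<union> ?R)" using Np RN[OF ab(1) r(2)] by blast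
    show "iso p r \<subseteq> insert a (?P \<union> ?R)"
    \<comment> \<open>A vertex outside with all its neighbours inside could be attached only to
      \<open>?P\<close>; it would then lie in \<open>iso w a\<close> and not be adjacent to
      \<open>b\<close>, hence lie in \<open>?R\<close>.\<close>
    proof (rule subsetI, rule ccontr)
      fix t assume t: "t \<in> iso p r" and n: "t \<notin> insert a (?P \<union> ?R)"
      have Nt: "N t \<noteq> {}" "N t \<subseteq> insert a (?P \<union> ?R)" using t sub unfolding iso_def by auto
      have bP: "b \<notin> N a" using deg[OF ab] by blast
      have "b \<notin> ?R" using isoD(2)[of b w a] ab unfolding R_def by blast
      then have "t \<noteq> w" using Nt(2) ab bP by auto
      then have taN: "t \<notin> N a" using n by blast
      then have "a \<notin> N t" using nsym by blast
      moreover have "s \<notin> N t" if "s \<in> ?R" for s using RN[OF ab(1) that] n nsym by blast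
      ultimately have NtP: "N t \<subseteq> ?P" using Nt(2) by blast
      have "w \<in> N b" using ab nsym by blast
      then have "t \<noteq> b" using NtP by blast
      then have "t \<in> iso w a" unfolding iso_def using Nt(1) NtP taN n ab(1) by auto
      then have "t \<in> ?R" unfolding R_def using NtP bP by blast
      then show False using n by blast
    qed
  qed (use finR nfin in simp)
  moreover have "card (insert a (?P \<union> ?R)) \<le> Suc (card (?P \<union> ?R))" by (rule card_insert_le_m1) auto
  moreover have "card (?P \<union> ?R) \<le> card ?P + card ?R" by (rule card_Un_le)
  ultimately show False using P3[OF ab] Rle by linarith
qed

lemma min_degree_3: "N x \<noteq> {} \<Longrightarrow> 3 \<le> card (N x)"
  using min_degree_2[of x] no_degree_2[of x] by linarith

subsection \<open>Minimum degree 3\<close>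

text \<open>With \<open>t\<close> common neighbours and \<open>U = N w \<union> N a\<close> the
  count reads \<open>36 + t \<le> 6 * |U|\<close>, while
  \<open>|U| + t = 3 + card (N a) \<le> 7\<close>; this leaves \<open>t = 0\<close>. If
  \<open>a\<close> had degree 3, equality would hold: four vertices in \<open>iso w a\<close>, four
  in \<open>Y\<close>, and exactly twelve edges between them, rigid enough for a nine-element set
  contradicting \<open>bad_subset\<close>.\<close>

lemma degree_3_nbr:
  assumes w: "card (N w) = 3" and a: "a \<in> N w"
  shows "card (N a) = 4" "N w \<inter> N a = {}"
proof -
  have "N w \<noteq> {}" using a by blast
  have "N a \<noteq> {}" using a nsym by blast
  then have a3: "3 \<le> card (N a)" by (rule min_degree_3)
  have bd: "36 + card (N w \<inter> N a) \<le> 6 * card (N w \<union> N a)"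
    using min_degree_bound[OF a, of 3] min_degree_3 by simp
  have "card (N w) + card (N a) = card (N w \<union> N a) + card (N w \<inter> N a)"
    using nfin by (intro card_Un_Int) auto
  then have "card (N w \<inter> N a) = 0" using bd w ncard[of a] by linarith
  then show disj: "N w \<inter> N a = {}" using nfin by simp
  show "card (N a) = 4"
  proof (rule ccontr)
    assume "card (N a) \<noteq> 4"
    then have na: "card (N a) = 3" using a3 ncard[of a] by linarith
    let ?I = "iso w a"
    define Y where "Y = N w \<union> N a - {w, a}"
    have wa: "w \<in> N a" using a nsym by blast
    have c6: "card (N w \<union> N a) = 6" using disj w na nfin by (simp add: card_Un_disjoint)
    have "a \<noteq> w" using a nirr by blast
    then have cY: "card Y = 4" unfolding Y_def using a wa c6
      by (subst card_Diff_subset) auto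
    have finY: "finite Y" unfolding Y_def using nfin by simp
    have I4: "4 \<le> card ?I" using bad[OF a] c6 by simp
    have NI: "N z \<subseteq> Y" if "z \<in> ?I" for z using isoD(1)[OF that a] by (simp add: Y_def)
    have disjYI: "Y \<inter> ?I = {}" unfolding Y_def iso_def by blast
    have yx: "w \<in> N y \<or> a \<in> N y" if "y \<in> Y" for y
      using that nsym[of y w] nsym[of y a] by (auto simp: Y_def)
    have yI: "card (N y \<inter> ?I) \<le> 3" if yY: "y \<in> Y" for y
    proof -
      obtain x where x: "x \<in> {w, a}" "x \<in> N y" using yx[OF yY] by auto
      then have "card (N y \<inter> ?I) \<le> card (N y - {x})"
        using nfin isoD(5,6)[OF _ a] by (intro card_mono) auto
      then show ?thesis using card_diff_nbr[OF x(2)] by linarith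
    qed
    have dc: "(\<Sum>z\<in>?I. card (N z \<inter> Y)) = (\<Sum>y\<in>Y. card (N y \<inter> ?I))"
      by (rule double_count[OF finite_iso finY])
    have ge: "3 \<le> card (N z \<inter> Y)" if "z \<in> ?I" for z
    proof -
      have "N z \<inter> Y = N z" using NI[OF that] by blast
      then show ?thesis using min_degree_3[of z] that unfolding iso_def by simp
    qed
    have lo: "3 * card ?I \<le> (\<Sum>z\<in>?I. card (N z \<inter> Y))"
      using sum_bounded_below[of ?I 3, OF ge] by (simp add: mult.commute)
    have hi: "(\<Sum>y\<in>Y. card (N y \<inter> ?I)) \<le> 12"
      using sum_bounded_above[of Y "\<lambda>y. card (N y \<inter> ?I)" 3, OF yI] cY by simp
    have cI: "card ?I = 4" using I4 lo hi dc by linarith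
    have y3: "card (N y \<inter> ?I) = 3" if "y \<in> Y" for y
      using sum_eq_boundD[OF finY that, of 3 "\<lambda>y. card (N y \<inter> ?I)"] yI lo dc cI cY by simp
    have NY: "N y \<subseteq> {w, a} \<union> ?I" if yY: "y \<in> Y" for y
    proof -
      obtain x where x: "x \<in> {w, a}" "x \<in> N y" using yx[OF yY] by auto
      have "x \<notin> ?I" using x(1) isoD(5,6)[OF _ a] by blast
      then have "card (insert x (N y \<inter> ?I)) = 4" using y3[OF yY] nfin by simp
      then have "insert x (N y \<inter> ?I) = N y" using x ncard[of y] nfin by (intro card_seteq) auto
      then show ?thesis using x(1) by blast
    qed
    have "card (N w - {a}) = 2" using w a by simp
    then have "N w - {a} \<noteq> {}" by (metis card.empty zero_neq_numeral)
    then obtain b where b: "b \<in> N w" "b \<noteq> a" by blast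
    have bY: "b \<in> Y" using b nirr[of w] unfolding Y_def by blast
    have "a \<notin> N b" using b disj nsym by blast
    then have Nb: "N b \<subseteq> insert w ?I" using NY[OF bY] by blast
    have "N b \<inter> ?I \<noteq> {}" using y3[OF bY] by auto
    then obtain z where z: "z \<in> N b" "z \<in> ?I" by blast
    \<comment> \<open>Otherwise \<open>z\<close> takes four of the twelve edges, leaving eight for
      three vertices that need nine.\<close>
    have "\<exists>y0\<in>Y. y0 \<notin> N z"
    proof (rule ccontr)
      assume "\<not> ?thesis"
      then have "N z \<inter> Y = Y" by blast
      then have "card (N z \<inter> Y) = 4" using cY by simp
      moreover have "sum (\<lambda>z. card (N z \<inter> Y)) ?I = card (N z \<inter> Y) + (\<Sum>z\<in>?I - {z}. card (N z \<inter> Y))"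
        using z finite_iso by (simp add: sum.remove)
      moreover have "3 * card (?I - {z}) \<le> (\<Sum>z\<in>?I - {z}. card (N z \<inter> Y))"
        using sum_bounded_below[of "?I - {z}" 3 "\<lambda>z. card (N z \<inter> Y)"] ge by (simp add: mult.commute)
      moreover have "card (?I - {z}) = 3" using cI z by simp
      ultimately show False using hi dc by linarith
    qed
    then obtain y0 where y0: "y0 \<in> Y" "y0 \<notin> N z" by blast
    let ?D = "{w, a} \<union> (Y - {y0}) \<union> ?I"
    have "10 \<le> card ?D"
    proof (rule bad_subset[OF z(1)])
      show sub: "N b \<union> N z \<subseteq> ?D" using Nb NI[OF z(2)] y0(2) by blast
      \<comment> \<open>Both \<open>y0\<close> and \<open>b\<close> have three neighbours in
        \<open>?I\<close>, but only \<open>b\<close> has \<open>z\<close>; so \<open>y0\<close> has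
        a neighbour there that is not deleted.\<close>
      have "y0 \<notin> iso b z"
      proof
        assume "y0 \<in> iso b z"
        from isoD(1)[OF this z(1)] have "N y0 \<inter> ?I \<subseteq> N b \<inter> ?I"
          using NI[OF z(2)] disjYI by blast
        moreover have "z \<notin> N y0" using y0 nsym by blast
        ultimately have "N y0 \<inter> ?I \<subset> N b \<inter> ?I" using z by blast
        then have "card (N y0 \<inter> ?I) < card (N b \<inter> ?I)" using nfin by (intro psubset_card_mono) auto
        then show False using y3[OF y0(1)] y3[OF bY] by simp
      qed
      moreover have "iso b z \<subseteq> {w, a} \<union> Y \<union> ?I"
      proof
        fix t assume t: "t \<in> iso b z"
        obtain s where s: "s \<in> N t" using isoD(4)[OF t z(1)] by blast
        then have "s \<in> N b \<union> N z" using t unfolding iso_def by blast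
        then have "s = w \<or> s \<in> ?I \<or> s \<in> Y" using Nb NI[OF z(2)] by blast
        moreover have "t \<in> N s" using s nsym by blast
        moreover have "N w \<subseteq> insert a Y" unfolding Y_def using nirr by blast
        ultimately show "t \<in> {w, a} \<union> Y \<union> ?I" using NI[of s] NY[of s] by blast
      qed
      ultimately show "iso b z \<subseteq> ?D" by blast
    qed (use finY finite_iso in simp)
    moreover have "card ?D \<le> card {w, a} + card (Y - {y0}) + card ?I"
      by (meson card_Un_le add_le_mono1 le_trans)
    moreover have "card (Y - {y0}) = 3" using y0(1) cY by simp
    moreover have "card {w, a} \<le> 2" by (simp add: card_insert_if)
    ultimately show False using cI by linarith
  qed
qed

text \<open>For the three neighbours \<open>x\<close> of \<open>w\<close>, the sets
  \<open>iso w x\<close> have at least three elements each and compete for the at most nine vertices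
  at distance two from \<open>w\<close>. Vertices escaping this competition and vertices shared by
  two of the sets are excluded, so the fit is exact, and the exact fit is contradictory as
  well.\<close>

lemma no_degree_3: "card (N w) \<noteq> 3"
proof
  assume w3: "card (N w) = 3"
  define A where "A x = N x - {w}" for x
  \<comment> \<open>For \<open>x \<in> N w\<close> these vertices have neighbourhood exactly
    \<open>A x\<close>. They are the only elements of \<open>iso w x\<close> outside the sets
    \<open>A y\<close> of the other two neighbours \<open>y\<close> of \<open>w\<close>, and
    \<open>R0\<close> removes them.\<close>
  define R where "R x = {z \<in> iso w x. N z \<subseteq> A x}" for x
  \<comment> \<open>An ordered listing of \<open>N w\<close>. The two swaps generate all
    reorderings, so a claim proved for one assignment of roles holds for all.\<close>
  define tri where "tri a b c \<longleftrightarrow> N w = {a, b, c} \<and> a \<noteq> b \<and> a \<noteq> c \<and> b \<noteq> c" for a b c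
  have swap1: "tri b a c" and swap2: "tri a c b" if "tri a b c" for a b c
    using that unfolding tri_def by (auto simp: insert_commute)
  have finA: "finite (A x)" for x unfolding A_def using nfin by simp
  have trimem: "a \<in> N w" "b \<in> N w" "c \<in> N w" if "tri a b c" for a b c
    using that unfolding tri_def by auto
  have A3: "card (A a) = 3" if "a \<in> N w" for a
    using degree_3_nbr(1)[OF w3 that] nsym[OF that] unfolding A_def by simp
  have NA: "N a = insert w (A a)" if "a \<in> N w" for a
    using nsym[OF that] unfolding A_def by blast
  have AwN: "A a \<inter> N w = {}" if "a \<in> N w" for a
    using degree_3_nbr(2)[OF w3 that] unfolding A_def by blast
  have memA: "a \<in> N x" if "x \<in> A a" for a x
    using that nsym unfolding A_def by blast
  have I3: "3 \<le> card (iso w a)" if "a \<in> N w" for a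
  proof -
    have "card (N w \<union> N a) = 7"
      using degree_3_nbr[OF w3 that] w3 nfin by (simp add: card_Un_disjoint)
    then show ?thesis using bad[OF that] by simp
  qed
  have I_N: "z \<notin> N a" "z \<notin> N w" "z \<notin> A a" "a \<notin> N z" "w \<notin> N z" "z \<noteq> w" "3 \<le> card (N z)"
    if z: "z \<in> iso w a" and a: "a \<in> N w" for a z
  proof -
    note zD = isoD[OF z a]
    show "z \<notin> N a" "z \<notin> N w" "z \<noteq> w" using zD by auto
    then show "z \<notin> A a" "a \<notin> N z" "w \<notin> N z" unfolding A_def using nsym by blast+
    show "3 \<le> card (N z)" using zD min_degree_3 by blast
  qed
  have IN: "N z \<subseteq> A a \<union> {b, c}" if t: "tri a b c" and z: "z \<in> iso w a" for a b c z
    using isoD(1)[OF z trimem(1)[OF t]] t unfolding A_def tri_def by auto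
  have RN: "N r = A a" if a: "a \<in> N w" and r: "r \<in> R a" for a r
  proof (rule card_seteq[OF finA])
    show "N r \<subseteq> A a" using r unfolding R_def by blast
    show "card (A a) \<le> card (N r)" using A3[OF a] I_N(7)[OF _ a] r unfolding R_def by simp
  qed
  have finR: "finite (R a)" for a unfolding R_def using finite_iso by simp
  \<comment> \<open>Three such vertices would use up every remaining edge at \<open>A a\<close>,
    closing off the set \<open>{a, w} \<union> A a \<union> R a\<close> of at most eight
    vertices.\<close>
  have R2: "card (R a) \<le> 2" if a: "a \<in> N w" for a
  proof (rule ccontr)
    assume "\<not> card (R a) \<le> 2"
    then have R3: "3 \<le> card (R a)" by simp
    have aR: "a \<notin> R a" using I_N(2)[OF _ a] a unfolding R_def by blast
    have Np: "N p = insert a (R a)" if p: "p \<in> A a" for p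
    proof -
      have "insert a (R a) \<subseteq> N p"
        using memA[OF p] RN[OF a] p nsym by blast
      then have "insert a (R a) = N p"
        using R3 aR finR ncard[of p] nfin by (intro card_seteq) auto
      then show ?thesis by simp
    qed
    have "R a \<noteq> {}" using R3 by auto
    then obtain r where r: "r \<in> R a" by blast
    have "A a \<noteq> {}" using A3[OF a] by auto
    then obtain p where p: "p \<in> A a" by blast
    have rp: "r \<in> N p" using Np[OF p] r by simp
    have "card (R a) \<le> 3" using Np[OF p] ncard[of p] aR finR by simp
    let ?D = "{a, w} \<union> A a \<union> R a"
    have "10 \<le> card ?D"
    proof (rule bad_subset[OF rp])
      show "N p \<union> N r \<subseteq> ?D" using Np[OF p] RN[OF a r] by auto
      show "iso p r \<subseteq> ?D"
      proof
        fix t assume t: "t \<in> iso p r"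
        obtain s where s: "s \<in> N t" using isoD(4)[OF t rp] by blast
        then have "s \<in> N p \<union> N r" using t unfolding iso_def by blast
        then have "s = a \<or> s \<in> R a \<or> s \<in> A a" using Np[OF p] RN[OF a r] by blast
        moreover have "t \<in> N s" using s nsym by blast
        ultimately show "t \<in> ?D" using NA[OF a] RN[OF a, of s] Np[of s] by blast
      qed
    qed (use finA finR in simp)
    moreover have "card ?D \<le> card {a, w} + card (A a) + card (R a)"
      by (meson card_Un_le add_le_mono1 le_trans)
    moreover have "card {a, w} \<le> 2" by (simp add: card_insert_if)
    ultimately show False using A3[OF a] \<open>card (R a) \<le> 3\<close> by linarith
  qed
  have Isub: "iso w a \<subseteq> R a \<union> (A b \<union> A c)" if t: "tri a b c" for a b c
  proof
    fix z assume z: "z \<in> iso w a"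
    show "z \<in> R a \<union> (A b \<union> A c)"
    proof (cases "N z \<subseteq> A a")
      case True then show ?thesis using z unfolding R_def by blast
    next
      case False
      then have "b \<in> N z \<or> c \<in> N z" using IN[OF t z] by blast
      then show ?thesis using I_N(6)[OF z trimem(1)[OF t]] nsym unfolding A_def by blast
    qed
  qed
  \<comment> \<open>A vertex \<open>p\<close> of the intersection is adjacent to
    \<open>r \<in> R a\<close>, and \<open>N p \<subseteq> A b \<union> {a, c}\<close> places
    \<open>r\<close> in \<open>A b\<close>. Then \<open>b \<in> N r = A a\<close>, but
    \<open>A a\<close> avoids \<open>N w\<close>.\<close>
  have noI: "A a \<inter> iso w b = {}" if t: "tri a b c" and R: "R a \<noteq> {}" for a b c
  proof (rule ccontr)
    assume "A a \<inter> iso w b \<noteq> {}"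
    then obtain p where p: "p \<in> A a" "p \<in> iso w b" by blast
    obtain r where r: "r \<in> R a" using R by blast
    have rp: "r \<in> N p" using RN[OF trimem(1)[OF t] r] p nsym by blast
    have "r \<in> A b \<union> {a, c}" using IN[OF swap1[OF t] p(2)] rp by blast
    moreover have "r \<notin> N w" using I_N(2)[OF _ trimem(1)[OF t]] r unfolding R_def by blast
    ultimately have "b \<in> N r" using memA trimem[OF t] by blast
    then have "b \<in> A a" using RN[OF trimem(1)[OF t] r] by simp
    then show False using AwN[OF trimem(1)[OF t]] trimem(2)[OF t] by blast
  qed
  have R_other: "R b = {}" if t: "tri a b c" and R: "R a \<noteq> {}" for a b c
  proof (rule ccontr)
    assume Rb: "R b \<noteq> {}"
    have t': "tri c a b" using t swap1 swap2 by blast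
    have "A a \<inter> iso w c = {}" using noI[OF swap2[OF t] R] .
    moreover have "A b \<inter> iso w c = {}" using noI[OF _ Rb, of c a] t swap1 swap2 by blast
    ultimately have "iso w c \<subseteq> R c" using Isub[OF t'] by blast
    then have "card (iso w c) \<le> card (R c)" using finR by (intro card_mono)
    then show False using R2[of c] I3[of c] trimem[OF t] by linarith
  qed
  have Asub: "A c \<subseteq> iso w b" if t: "tri a b c" and R: "R a \<noteq> {}" for a b c
  proof -
    have "iso w b \<subseteq> A c" using Isub[OF swap1[OF t]] R_other[OF t R] noI[OF t R] by blast
    then have "iso w b = A c" using I3[of b] A3[of c] trimem[OF t] finA by (intro card_seteq) auto
    then show ?thesis by simp
  qed
  \<comment> \<open>Such an \<open>x\<close> would lie in \<open>iso w c\<close> too, and the two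
    restrictions on its neighbourhood leave only \<open>b\<close>.\<close>
  have noT: "A b \<inter> iso w a = {}" if t: "tri a b c" and R: "R a \<noteq> {}" for a b c
  proof (rule ccontr)
    assume "A b \<inter> iso w a \<noteq> {}"
    then obtain x where x: "x \<in> A b" "x \<in> iso w a" by blast
    have t': "tri c a b" using t swap1 swap2 by blast
    have xc: "x \<in> iso w c" using Asub[OF swap2[OF t] R] x by blast
    have "N x \<subseteq> A a \<union> {b, c}" "N x \<subseteq> A c \<union> {a, b}" using IN[OF t x(2)] IN[OF t' xc] by auto
    moreover have "a \<notin> N x" "c \<notin> N x" using I_N(4) x(2) xc trimem[OF t] by auto
    moreover have "A a \<inter> A c = {}" using Asub[OF t R] noI[OF t R] by blast
    ultimately have "N x \<subseteq> {b}" by blast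
    then have "card (N x) \<le> 1" using card_mono[of "{b}" "N x"] by simp
    then show False using I_N(7)[OF x(2)] trimem[OF t] by simp
  qed
  have R0: "R a = {}" if t: "tri a b c" for a b c
  proof (rule ccontr)
    assume R: "R a \<noteq> {}"
    have "iso w a \<subseteq> R a" using Isub[OF t] noT[OF t R] noT[OF swap2[OF t] R] by blast
    then have "card (iso w a) \<le> card (R a)" using finR by (intro card_mono)
    then show False using R2[of a] I3[of a] trimem[OF t] by linarith
  qed
  have Isub': "iso w a \<subseteq> (A b \<union> A c) - A a" if t: "tri a b c" for a b c
    using Isub[OF t] R0[OF t] I_N(3)[OF _ trimem(1)[OF t]] by blast

  \<comment> \<open>Equality forces the three sets \<open>iso w x\<close> to be \<open>A c\<close>,
    \<open>A c\<close> and \<open>A a\<close>, and nine vertices enclose the edge \<open>aq\<close>.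
    The vertex \<open>c\<close> stays out of \<open>iso a q\<close> because otherwise
    \<open>q\<close> would be adjacent to \<open>a\<close>, \<open>b\<close> and all of
    \<open>A c\<close>.\<close>
  have same: "A a \<noteq> A b" if t: "tri a b c" for a b c
  proof
    assume eq: "A a = A b"
    note m = trimem[OF t]
    have t': "tri c a b" using t swap1 swap2 by blast
    have eqs: "iso w a = A c" "iso w b = A c" "iso w c = A a"
    proof -
      show "iso w a = A c" using Isub'[OF t] eq I3[OF m(1)] A3[OF m(3)] finA by (intro card_seteq) auto
      show "iso w b = A c" using Isub'[OF swap1[OF t]] eq I3[OF m(2)] A3[OF m(3)] finA by (intro card_seteq) auto
      show "iso w c = A a" using Isub'[OF t'] eq I3[OF m(3)] A3[OF m(1)] finA by (intro card_seteq) auto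
    qed
    have NAa: "N q \<subseteq> A c \<union> {a, b}" if "q \<in> A a" for q using IN[OF t', of q] eqs(3) that by simp
    have NAc: "N z \<subseteq> A a \<union> {c}" if "z \<in> A c" for z
    proof -
      have "z \<in> iso w a" "z \<in> iso w b" using that eqs by auto
      then show ?thesis using IN[OF t, of z] I_N(4)[of z b] m by blast
    qed
    have "A a \<noteq> {}" using A3[OF m(1)] by auto
    then obtain q where q: "q \<in> A a" by blast
    have qa: "q \<in> N a" using q unfolding A_def by blast
    let ?D = "{w, a, b} \<union> A a \<union> A c"
    have "10 \<le> card ?D"
    proof (rule bad_subset[OF qa])
      show "N a \<union> N q \<subseteq> ?D" using NA[OF m(1)] NAa[OF q] by blast
      have "c \<notin> iso a q"
      proof
        assume "c \<in> iso a q"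
        then have "A c \<subseteq> N a \<union> N q" unfolding A_def iso_def by blast
        moreover have "A c \<inter> N a = {}" using I_N(1)[OF _ m(1)] eqs(1) by blast
        ultimately have sub: "insert a (insert b (A c)) \<subseteq> N q" using memA q eq by blast
        have "a \<notin> A c" "b \<notin> A c" "a \<noteq> b" using AwN[OF m(3)] m t unfolding tri_def by auto
        then have "card (insert a (insert b (A c))) = 5" using A3[OF m(3)] finA by simp
        then show False using card_mono[OF nfin sub] ncard[of q] by linarith
      qed
      moreover have "iso a q \<subseteq> insert c ?D"
      proof
        fix x assume x: "x \<in> iso a q"
        obtain s where s: "s \<in> N x" using isoD(4)[OF x qa] by blast
        then have "s \<in> N a \<union> N q" using x unfolding iso_def by blast
        then have "s = w \<or> s \<in> A a \<or> s \<in> A c \<or> s = a \<or> s = b"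
          using NA[OF m(1)] NAa[OF q] by blast
        moreover have "x \<in> N s" using s nsym by blast
        moreover have "N w \<subseteq> {a, b, c}" using t unfolding tri_def by simp
        ultimately show "x \<in> insert c ?D"
          using NA[OF m(1)] NA[OF m(2)] NAa[of s] NAc[of s] eq by blast
      qed
      ultimately show "iso a q \<subseteq> ?D" by blast
    qed (use finA in simp)
    moreover have "card ?D \<le> card {w, a, b} + card (A a) + card (A c)"
      by (meson card_Un_le add_le_mono1 le_trans)
    moreover have "card {w, a, b} \<le> 3" by (simp add: card_insert_if)
    ultimately show False using A3 m by simp
  qed

  \<comment> \<open>A vertex in both sets avoids \<open>a\<close> and \<open>b\<close>, so its
    neighbours lie in \<open>insert c (A a \<inter> A b)\<close>. Its degree and \<open>same\<close>
    make the intersection have size exactly two.\<close>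
  have double: "card (A a \<inter> A b) = 2 \<and> (\<forall>z \<in> iso w a \<inter> iso w b. N z = insert c (A a \<inter> A b))"
    if t: "tri a b c" and z0: "z0 \<in> iso w a \<inter> iso w b" for a b c z0
  proof -
    note m = trimem[OF t]
    have cQ: "c \<notin> A a \<inter> A b" using AwN[OF m(1)] m by blast
    have sub: "N z \<subseteq> insert c (A a \<inter> A b)" if z: "z \<in> iso w a \<inter> iso w b" for z
    proof -
      have "N z \<subseteq> A a \<union> {b, c}" "N z \<subseteq> A b \<union> {a, c}"
        using IN[OF t, of z] IN[OF swap1[OF t], of z] z by auto
      moreover have "a \<notin> N z" "b \<notin> N z" using I_N(4) z m by auto
      ultimately show ?thesis by blast
    qed
    have fin: "finite (insert c (A a \<inter> A b))" using finA by simp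
    have ge: "3 \<le> card (N z)" if "z \<in> iso w a \<inter> iso w b" for z using that I_N(7) m by auto
    have "3 \<le> card (insert c (A a \<inter> A b))"
      using ge[OF z0] card_mono[OF fin sub[OF z0]] by linarith
    then have 2: "2 \<le> card (A a \<inter> A b)" using cQ finA by simp
    have "card (A a \<inter> A b) \<noteq> 3"
    proof
      assume "card (A a \<inter> A b) = 3"
      then have "A a \<inter> A b = A a" "A a \<inter> A b = A b"
        using A3 m finA by (intro card_seteq; simp)+
      then show False using same[OF t] by blast
    qed
    moreover have "card (A a \<inter> A b) \<le> 3" using card_mono[OF finA, of "A a \<inter> A b" a] A3[OF m(1)] by simp
    ultimately have c2: "card (A a \<inter> A b) = 2" using 2 by linarith
    moreover have "N z = insert c (A a \<inter> A b)" if z: "z \<in> iso w a \<inter> iso w b" for z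
      using ge[OF z] c2 cQ finA by (intro card_seteq[OF fin sub[OF z]]) simp
    ultimately show ?thesis by blast
  qed

  have split: "\<exists>p. A a \<subseteq> insert p (A b)"
    if t: "tri a b c" and c2: "card (A a \<inter> A b) = 2" for a b c
  proof -
    have "card (A a - A b) = 1"
      using card_Int_Diff[OF finA, of a "A b"] A3[OF trimem(1)[OF t]] c2 by simp
    then obtain p where "A a - A b = {p}" by (auto simp: card_1_singleton_iff)
    then show ?thesis by blast
  qed

  \<comment> \<open>Otherwise \<open>iso w a = A c\<close>, and the elements of \<open>?Q\<close>
    spend all four edges on \<open>a\<close>, \<open>b\<close> and \<open>?Z\<close>. A vertex
    \<open>z\<close> of \<open>A c\<close> outside \<open>iso w b\<close> then has
    \<open>N z \<subseteq> {p, b, c}\<close>; being adjacent to \<open>b\<close> it must be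
    \<open>p'\<close>.\<close>
  have step1: "p' \<in> iso w a"
    if t: "tri a b c" and z0: "z0 \<in> iso w a \<inter> iso w b"
      and p': "A b \<subseteq> insert p' (A a)" and p: "A a \<subseteq> insert p (A b)" for a b c z0 p p'
  proof (rule ccontr)
    assume n: "p' \<notin> iso w a"
    note m = trimem[OF t]
    let ?Q = "A a \<inter> A b" and ?Z = "iso w b \<inter> A c"
    note db = double[OF t z0]
    have "iso w a \<subseteq> A c" using Isub'[OF t] p' n by blast
    then have Ia: "iso w a = A c" using I3[OF m(1)] A3[OF m(3)] finA by (intro card_seteq) auto
    have "iso w b \<subseteq> insert p ?Z" using Isub'[OF swap1[OF t]] p by blast
    then have "card (iso w b) \<le> card (insert p ?Z)" using finA by (intro card_mono) auto
    also have "\<dots> \<le> Suc (card ?Z)" by (simp add: card_insert_if finA)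
    finally have Z2: "2 \<le> card ?Z" using I3[OF m(2)] by linarith
    have abn: "a \<notin> ?Z" "b \<notin> ?Z" "a \<noteq> b" using AwN[OF m(3)] m t unfolding tri_def by auto
    have Nq: "N q = insert a (insert b ?Z)" if q: "q \<in> ?Q" for q
    proof -
      have "insert a (insert b ?Z) \<subseteq> N q"
        using memA q db Ia nsym by blast
      then have "insert a (insert b ?Z) = N q"
        using Z2 abn finA ncard[of q] nfin by (intro card_seteq) auto
      then show ?thesis by simp
    qed
    have "?Q \<noteq> {}" using db by auto
    then obtain q where q: "q \<in> ?Q" by blast
    have "card ?Z \<le> 2" using Nq[OF q] ncard[of q] abn finA by simp
    have "\<not> A c \<subseteq> iso w b"
    proof
      assume "A c \<subseteq> iso w b"
      then have "?Z = A c" by blast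
      then show False using A3[OF m(3)] \<open>card ?Z \<le> 2\<close> by simp
    qed
    then obtain z where z: "z \<in> A c" "z \<notin> iso w b" by blast
    have zI: "z \<in> iso w a" using z Ia by simp
    have zW: "z \<notin> N w" using I_N(2)[OF zI m(1)] .
    have "q \<notin> N z" if "q \<in> ?Q" for q
    proof
      assume "q \<in> N z"
      then have "z \<in> N q" using nsym by blast
      then show False using Nq[OF that] z zW m by auto
    qed
    then have sub: "N z \<subseteq> {p, b, c}" using IN[OF t zI] p by blast
    have "b \<in> N z"
    proof (rule ccontr)
      assume "b \<notin> N z"
      then have "N z \<subseteq> {p, c}" using sub by blast
      then have "card (N z) \<le> card {p, c}" by (intro card_mono) auto
      then show False using I_N(7)[OF zI m(1)] by (simp add: card_insert_if split: if_splits)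
    qed
    then have "z \<in> A b" using nsym I_N(6)[OF zI m(1)] unfolding A_def by blast
    then have "z = p'" using p' I_N(3)[OF zI m(1)] by blast
    then show False using n zI by blast
  qed

  \<comment> \<open>Let \<open>p\<close> and \<open>p'\<close> be the elements by which
    \<open>A a\<close> and \<open>A b\<close> exceed \<open>?Q\<close>. Neither is in
    \<open>iso w c\<close>, so its at least three vertices would have to fit into the two-element
    set \<open>?Q\<close>.\<close>
  have no_double: "iso w a \<inter> iso w b = {}" if t: "tri a b c" for a b c
  proof (rule ccontr)
    assume "iso w a \<inter> iso w b \<noteq> {}"
    then obtain z where z: "z \<in> iso w a \<inter> iso w b" by blast
    then have z': "z \<in> iso w b \<inter> iso w a" by blast
    note m = trimem[OF t]
    let ?Q = "A a \<inter> A b"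
    have c2: "card ?Q = 2" using double[OF t z] by blast
    obtain p where p: "A a \<subseteq> insert p (A b)" using split[OF t c2] by blast
    have c2': "card (A b \<inter> A a) = 2" using c2 by (simp add: Int_commute)
    obtain p' where p': "A b \<subseteq> insert p' (A a)"
      using split[OF swap1[OF t] c2'] by blast
    have pI: "p' \<in> iso w a" using step1[OF t z p' p] .
    have pI': "p \<in> iso w b" using step1[OF swap1[OF t] z' p p'] .
    have t': "tri c a b" using t swap1 swap2 by blast
    have nc: "p' \<notin> A c"
      if t: "tri a b c" and c2: "card (A a \<inter> A b) = 2" and p: "A a \<subseteq> insert p (A b)"
        and p': "A b \<subseteq> insert p' (A a)" and pI': "p \<in> iso w b"
      for a b c p p'
    proof
      assume pc: "p' \<in> A c"
      let ?Q = "A a \<inter> A b"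
      note m = trimem[OF t]
      have t': "tri c a b" using t swap1 swap2 by blast
      have fQ: "finite (insert p ?Q)" using finA by simp
      have "iso w c \<subseteq> insert p ?Q" using Isub'[OF t'] p p' pc by blast
      moreover have "card (insert p ?Q) \<le> 3" using c2 by (simp add: card_insert_if finA)
      ultimately have Ic: "iso w c = insert p ?Q" using I3[OF m(3)] by (intro card_seteq[OF fQ]) auto
      then have pIc: "p \<in> iso w c" by blast
      have "N p \<subseteq> A c \<union> {a, b}" "N p \<subseteq> A b \<union> {a, c}" using IN[OF t' pIc] IN[OF swap1[OF t] pI'] by auto
      moreover have "b \<notin> N p" "c \<notin> N p" using I_N(4) pI' pIc m by auto
      moreover have "A b \<inter> A c \<subseteq> {p'}" using p' Ic I_N(3)[OF _ m(3)] by blast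
      ultimately have "N p \<subseteq> {a, p'}" by blast
      then have "card (N p) \<le> card {a, p'}" by (intro card_mono) auto
      then show False using I_N(7)[OF pI' m(2)] by (simp add: card_insert_if split: if_splits)
    qed
    have p'c: "p' \<notin> A c" using nc[OF t c2 p p' pI'] .
    have pc: "p \<notin> A c" using nc[OF swap1[OF t] c2' p' p pI] .
    have nI: "p' \<notin> iso w c"
      if t: "tri a b c" and c2: "card (A a \<inter> A b) = 2" and p: "A a \<subseteq> insert p (A b)"
        and p': "A b \<subseteq> insert p' (A a)" and pI: "p' \<in> iso w a" and pc: "p \<notin> A c"
      for a b c p p'
    proof
      assume pIc: "p' \<in> iso w c"
      let ?Q = "A a \<inter> A b"
      note m = trimem[OF t]
      have t': "tri c a b" using t swap1 swap2 by blast
      have "N p' \<subseteq> A c \<union> {a, b}" "N p' \<subseteq> A a \<union> {b, c}" using IN[OF t' pIc] IN[OF t pI] by auto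
      moreover have "a \<notin> N p'" "c \<notin> N p'" using I_N(4) pI pIc m by auto
      moreover have "A a \<inter> A c \<subseteq> ?Q \<inter> A c" using p pc by blast
      ultimately have "N p' \<subseteq> insert b (?Q \<inter> A c)" by blast
      then have "card (N p') \<le> card (insert b (?Q \<inter> A c))" using finA by (intro card_mono) auto
      also have "\<dots> \<le> Suc (card (?Q \<inter> A c))" by (simp add: card_insert_if finA)
      finally have "card ?Q \<le> card (?Q \<inter> A c)" using I_N(7)[OF pI m(1)] c2 by linarith
      then have "?Q \<inter> A c = ?Q" using finA by (intro card_seteq) auto
      then have "iso w c \<subseteq> {p, p'}" using Isub'[OF t'] p p' by blast
      then have "card (iso w c) \<le> card {p, p'}" by (intro card_mono) auto
      then show False using I3[OF m(3)] by (simp add: card_insert_if split: if_splits)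
    qed
    have "p' \<notin> iso w c" using nI[OF t c2 p p' pI pc] .
    moreover have "p \<notin> iso w c" using nI[OF swap1[OF t] c2' p' p pI' p'c] .
    ultimately have "iso w c \<subseteq> ?Q" using Isub'[OF t'] p p' by blast
    then have "card (iso w c) \<le> 2" using c2 card_mono[of ?Q "iso w c"] finA by simp
    then show False using I3[OF m(3)] by simp
  qed

  obtain a b c where t: "tri a b c" using w3 unfolding tri_def card_3_iff by blast
  note m = trimem[OF t]
  let ?I = "iso w a \<union> iso w b \<union> iso w c" and ?U = "A a \<union> A b \<union> A c"
  have t': "tri c a b" using t swap1 swap2 by blast
  have "iso w a \<inter> iso w b = {}" "iso w a \<inter> iso w c = {}" "iso w b \<inter> iso w c = {}"
    using no_double[OF t] no_double[OF swap2[OF t]] no_double[OF swap2[OF swap1[OF t]]] by auto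
  then have "card ?I = card (iso w a) + card (iso w b) + card (iso w c)"
    using finite_iso by (simp add: card_Un_disjoint Int_Un_distrib2)
  then have I9: "9 \<le> card ?I" using I3[OF m(1)] I3[OF m(2)] I3[OF m(3)] by linarith
  have finU: "finite ?U" using finA by simp
  have IU: "?I \<subseteq> ?U" using Isub'[OF t] Isub'[OF swap1[OF t]] Isub'[OF t'] by blast
  have U9: "9 \<le> card ?U" using card_mono[OF finU IU] I9 by linarith
  have "card ?U \<le> card (A a) + card (A b) + card (A c)"
    by (meson card_Un_le add_le_mono1 le_trans)
  then have "card ?U \<le> card ?I" using I9 A3 m by simp
  \<comment> \<open>Disjoint sets of total size at least nine inside a union of three 3-sets: all
    estimates are equalities, and the sets \<open>A x\<close> are disjoint.\<close>
  then have UI: "?I = ?U" using IU by (intro card_seteq[OF finU])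
  have disj: "A x \<inter> A y = {}" if s: "tri x y z" for x y z
  proof -
    have "?U = (\<Union>v\<in>N w. A v)" "(\<Union>v\<in>N w. A v) = A x \<union> A y \<union> A z"
      using t s unfolding tri_def by auto
    then have U: "?U = A x \<union> A y \<union> A z" by simp
    note s3 = trimem[OF s]
    have "card ?U \<le> card (A x \<union> A y) + card (A z)" unfolding U by (rule card_Un_le)
    then have "6 \<le> card (A x \<union> A y)" using U9 A3[OF s3(3)] by linarith
    moreover have "card (A x) + card (A y) = card (A x \<union> A y) + card (A x \<inter> A y)"
      using finA by (intro card_Un_Int)
    ultimately have "card (A x \<inter> A y) = 0" using A3 s3 by simp
    then show ?thesis using finA by simp
  qed
  have U_eq: "?I = iso w x \<union> iso w y \<union> iso w z" if s: "tri x y z" for x y z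
  proof -
    have "?I = (\<Union>v\<in>N w. iso w v)" "(\<Union>v\<in>N w. iso w v) = iso w x \<union> iso w y \<union> iso w z"
      using t s unfolding tri_def by auto
    then show ?thesis by simp
  qed
  have U_mem: "A x \<subseteq> iso w x \<union> iso w y \<union> iso w z" if s: "tri x y z" for x y z
  proof -
    have "A x \<subseteq> ?U" using trimem(1)[OF s] t unfolding tri_def by auto
    then show ?thesis using UI U_eq[OF s] by simp
  qed
  \<comment> \<open>All neighbours of \<open>p\<close> except \<open>x\<close> lie in
    \<open>A y\<close>, and the exact fit leaves \<open>iso w x\<close> as the only place for
    them.\<close>
  have two: "2 \<le> card (A y \<inter> iso w x)" if s: "tri x y z" and p: "p \<in> A x \<inter> iso w y" for x y z p
  proof -
    note s3 = trimem[OF s]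
    have s': "tri z x y" "tri y z x" using s swap1 swap2 by blast+
    have pw: "p \<noteq> w" "p \<notin> N w" using I_N(2,6)[OF _ s3(2)] p by auto
    have "p \<notin> A z" using disj[OF swap2[OF s]] p by blast
    then have "z \<notin> N p" using nsym pw unfolding A_def by blast
    then have sub: "N p - {x} \<subseteq> A y" using IN[OF swap1[OF s], of p] p by blast
    have "N p - {x} \<subseteq> A y \<inter> iso w x"
    proof
      fix q assume q: "q \<in> N p - {x}"
      then have qy: "q \<in> A y" using sub by blast
      have pq: "p \<in> N q" using q nsym by blast
      have "q \<notin> iso w z"
      proof
        assume "q \<in> iso w z"
        then have "p \<in> A z \<union> {x, y}" using IN[OF s'(1)] pq by blast
        then show False using \<open>p \<notin> A z\<close> pw s3 by blast
      qed
      moreover have "q \<notin> iso w y" using I_N(3)[OF _ s3(2)] qy by blast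
      ultimately have "q \<in> iso w x" using U_mem[OF s'(2)] qy by blast
      then show "q \<in> A y \<inter> iso w x" using qy by blast
    qed
    then have "card (N p - {x}) \<le> card (A y \<inter> iso w x)" using finA by (intro card_mono) auto
    moreover have "x \<in> N p" using memA p by blast
    moreover have "3 \<le> card (N p)" using I_N(7)[OF _ s3(2)] p by blast
    ultimately show ?thesis by simp
  qed
  \<comment> \<open>Using \<open>two\<close> back and forth, a meeting of \<open>A x\<close> with
    \<open>iso w y\<close> takes two of the three elements of \<open>A x\<close>, and likewise for
    \<open>A y\<close> with \<open>iso w x\<close>. Neither can then meet \<open>iso w z\<close>,
    which would be empty.\<close>
  have none: "A x \<inter> iso w y = {}" if s: "tri x y z" for x y z
  proof (rule ccontr)
    assume ne: "A x \<inter> iso w y \<noteq> {}"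
    note s3 = trimem[OF s]
    have s': "tri z x y" using s swap1 swap2 by blast
    have other: "A x \<inter> iso w z = {}" if s: "tri x y z" and ne: "A x \<inter> iso w y \<noteq> {}" for x y z
    proof (rule ccontr)
      assume ne': "A x \<inter> iso w z \<noteq> {}"
      have both: "2 \<le> card (A x \<inter> iso w y)" if s: "tri x y z" and ne: "A x \<inter> iso w y \<noteq> {}" for x y z
      proof -
        obtain p where "p \<in> A x \<inter> iso w y" using ne by blast
        then have "2 \<le> card (A y \<inter> iso w x)" by (rule two[OF s])
        then have "A y \<inter> iso w x \<noteq> {}" by auto
        then obtain q where "q \<in> A y \<inter> iso w x" by blast
        then show ?thesis by (rule two[OF swap1[OF s]])
      qed
      have "2 \<le> card (A x \<inter> iso w y)" "2 \<le> card (A x \<inter> iso w z)"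
        using both[OF s ne] both[OF swap2[OF s] ne'] by auto
      moreover have "card ((A x \<inter> iso w y) \<union> (A x \<inter> iso w z)) = card (A x \<inter> iso w y) + card (A x \<inter> iso w z)"
      proof (rule card_Un_disjoint)
        have "tri y z x" using s swap1 swap2 by blast
        then show "A x \<inter> iso w y \<inter> (A x \<inter> iso w z) = {}" using no_double by blast
      qed (use finA in auto)
      moreover have "card ((A x \<inter> iso w y) \<union> (A x \<inter> iso w z)) \<le> card (A x)"
        using finA by (intro card_mono) auto
      ultimately show False using A3 trimem(1)[OF s] by simp
    qed
    obtain p where "p \<in> A x \<inter> iso w y" using ne by blast
    then have "2 \<le> card (A y \<inter> iso w x)" by (rule two[OF s])
    then have ne2: "A y \<inter> iso w x \<noteq> {}" by auto
    have "A x \<inter> iso w z = {}" "A y \<inter> iso w z = {}"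
      using other[OF s ne] other[OF swap1[OF s] ne2] by auto
    then have "iso w z = {}" using Isub'[OF s'] by blast
    then show False using I3[OF s3(3)] by simp
  qed
  have "A a = {}" using U_mem[OF t] none[OF t] none[OF swap2[OF t]] I_N(3)[OF _ m(1)] by blast
  then show False using A3[OF m(1)] by simp
qed

lemma degree_4: "N x \<noteq> {} \<Longrightarrow> card (N x) = 4"
  using min_degree_3[of x] no_degree_3[of x] ncard[of x] by linarith

subsection \<open>The 4-regular case\<close>

lemma third_nbr:
  assumes "y \<in> N x"
  shows "\<exists>r\<in>N x. r \<noteq> p \<and> r \<noteq> q"
proof (rule ccontr)
  assume "\<not> ?thesis"
  then have "N x \<subseteq> {p, q}" by blast
  then have "card (N x) \<le> card {p, q}" by (intro card_mono) auto
  moreover have "card (N x) = 4" using assms degree_4 by blast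
  ultimately show False by (simp add: card_insert_if split: if_splits)
qed

text \<open>The count puts an edge in at most one triangle. In a triangle \<open>u, v, c\<close>,
  the vertices of \<open>iso u v\<close> and a suitable \<open>t \<in> iso u c\<close> have forced
  neighbourhoods, so a further neighbour \<open>a\<close> of \<open>u\<close> is adjacent to
  \<open>u\<close>, to \<open>t\<close> and to three vertices of \<open>iso u v\<close>: five
  neighbours.\<close>

lemma triangle_free:
  assumes uv: "v \<in> N u"
  shows "N u \<inter> N v = {}"
proof (rule ccontr)
  assume "N u \<inter> N v \<noteq> {}"
  then obtain c where c: "c \<in> N u" "c \<in> N v" by blast
  have le1: "card (N x \<inter> N y) \<le> 1 \<and> card (N x \<union> N y) + card (N x \<inter> N y) = 8" if "y \<in> N x" for x y
  proof -
    have "N x \<noteq> {}" "N y \<noteq> {}" using that nsym by blast+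
    then have "card (N x) + card (N y) = 8" using degree_4 by simp
    then have s: "card (N x \<union> N y) + card (N x \<inter> N y) = 8"
      using card_Un_Int[OF nfin nfin, of x y] by simp
    have "46 + card (N x \<inter> N y) \<le> 7 * card (N x \<union> N y)"
      using min_degree_bound[OF that, of 4] degree_4 by simp
    then show ?thesis using s by linarith
  qed
  have uniq: "s = t" if "y \<in> N x" "s \<in> N x" "s \<in> N y" "t \<in> N x" "t \<in> N y" for x y s t
  proof -
    have "card (N x \<inter> N y) \<le> Suc 0" using le1[OF that(1)] by simp
    then show ?thesis using that nfin by (subst (asm) card_le_Suc0_iff_eq) auto
  qed
  have I3: "3 \<le> card (iso x y) \<and> card (N x \<union> N y - {x, y, t}) = 4"
    if "y \<in> N x" "t \<in> N x" "t \<in> N y" for x y t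
  proof -
    have "t \<in> N x \<inter> N y" using that by blast
    then have "card (N x \<inter> N y) \<noteq> 0" using nfin by auto
    then have 7: "card (N x \<union> N y) = 7" using le1[OF that(1)] by linarith
    have "x \<noteq> y" "x \<noteq> t" "y \<noteq> t" using that nirr by auto
    then have "card {x, y, t} = 3" by simp
    moreover have "{x, y, t} \<subseteq> N x \<union> N y" using that nsym by blast
    ultimately have "card (N x \<union> N y - {x, y, t}) = 4" using 7 by (subst card_Diff_subset) auto
    then show ?thesis using bad[OF that(1)] 7 by simp
  qed
  have Neq: "N z = N x \<union> N y - {x, y, t}"
    if "y \<in> N x" "t \<in> N x" "t \<in> N y" "z \<in> iso x y" "t \<notin> N z" for x y t z
  proof (rule card_seteq)
    show "N z \<subseteq> N x \<union> N y - {x, y, t}" using isoD(1)[OF that(4,1)] that(5) by blast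
    have "N z \<noteq> {}" using that(4) unfolding iso_def by blast
    then show "card (N x \<union> N y - {x, y, t}) \<le> card (N z)"
      using I3[OF that(1-3)] degree_4 by simp
  qed (use nfin in simp)
  \<comment> \<open>Two of the four edges at \<open>t\<close> go to \<open>x\<close> and
    \<open>y\<close>, so \<open>t\<close> misses one of the three vertices of
    \<open>iso x y\<close>.\<close>
  have ex: "\<exists>z\<in>iso x y. t \<notin> N z" if h: "y \<in> N x" "t \<in> N x" "t \<in> N y" for x y t
  proof (rule ccontr)
    assume "\<not> ?thesis"
    then have "iso x y \<subseteq> N t - {x, y}" using isoD(5,6)[OF _ h(1)] nsym by blast
    then have "card (iso x y) \<le> card (N t - {x, y})" using nfin by (intro card_mono) auto
    moreover have "{x, y} \<subseteq> N t" "x \<noteq> y" using h nsym nirr by blast+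
    then have "card (N t - {x, y}) \<le> 2" using ncard[of t] by (subst card_Diff_subset) auto
    ultimately show False using I3[OF h] by linarith
  qed
  have h1: "c \<in> N u" "v \<in> N u" "v \<in> N c" using uv c nsym by blast+
  obtain t where t: "t \<in> iso u c" "v \<notin> N t" using ex[OF h1] by blast
  have Nt: "N t = N u \<union> N c - {u, c, v}" using Neq[OF h1 t] .
  note tD = isoD[OF t(1) h1(1)]
  have cz: "c \<notin> N z" if z: "z \<in> iso u v" for z
  proof
    assume cz: "c \<in> N z"
    have zc: "z \<in> N c" using cz nsym by blast
    have "z \<noteq> c" using cz nirr by blast
    then have "z \<in> N t" using Nt zc isoD(5,6)[OF z uv] by simp
    then have "t \<in> N z" using nsym by blast
    then have "t \<in> N u \<union> N v" using isoD(1)[OF z uv] by blast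
    then show False using tD t(2) nsym by blast
  qed
  have Nz: "N z = N u \<union> N v - {u, v, c}" if z: "z \<in> iso u v" for z
    using Neq[OF uv c z cz[OF z]] .
  obtain a where a: "a \<in> N u" "a \<noteq> v" "a \<noteq> c" using third_nbr[OF uv] by blast
  obtain x where x: "x \<in> N c" "x \<noteq> u" "x \<noteq> v" using third_nbr[OF h1(3)] by blast
  have "x \<noteq> c" using x nirr by blast
  have xt: "x \<in> N t" using Nt x \<open>x \<noteq> c\<close> by simp
  have "x \<notin> N u" using uniq[OF h1(1), of x v] x h1 by blast
  moreover have "x \<notin> N v" using uniq[of c v x u] x c(2) nsym[OF uv] nsym[OF c(1)] by blast
  ultimately have tn: "t \<notin> iso u v" using isoD(1)[OF _ uv, of t] xt by blast
  have "a \<noteq> u" using a nirr by blast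
  then have "a \<in> N z" if "z \<in> iso u v" for z using Nz[OF that] a by simp
  moreover have "a \<in> N t" using Nt a \<open>a \<noteq> u\<close> by simp
  ultimately have sub: "insert u (insert t (iso u v)) \<subseteq> N a" using a nsym by blast
  have "u \<notin> iso u v" using isoD(5)[OF _ uv] by blast
  then have "card (insert u (insert t (iso u v))) = card (iso u v) + 2"
    using tn tD(5) finite_iso by auto
  then show False using card_mono[OF nfin sub] ncard[of a] I3[OF uv c] by linarith
qed

section \<open>Common neighbours and twins in the triangle-free case\<close>

lemma nbrs_nonadjacent: "y \<in> N x \<Longrightarrow> z \<in> N x \<Longrightarrow> z \<notin> N y"
  using triangle_free[of y x] by blast

lemma iso_ge_2:
  assumes "y \<in> N x"
  shows "2 \<le> card (iso x y)"
proof -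
  have "N x \<noteq> {}" "N y \<noteq> {}" using assms nsym by blast+
  then have "card (N x \<union> N y) = 8"
    using triangle_free[OF assms] nfin degree_4 by (simp add: card_Un_disjoint)
  then show ?thesis using bad[OF assms] by simp
qed

lemma degree_4': "y \<in> N x \<Longrightarrow> card (N x) = 4"
  using degree_4 by blast

lemma N_eqI:
  assumes "{p, q, r, s} \<subseteq> N x" "p \<noteq> q" "p \<noteq> r" "p \<noteq> s" "q \<noteq> r" "q \<noteq> s" "r \<noteq> s"
  shows "N x = {p, q, r, s}"
  using card_seteq[OF nfin assms(1)] ncard[of x] assms(2-) by simp

text \<open>Each common neighbour \<open>a\<close> yields, through the edge \<open>ua\<close>, a
  vertex \<open>y\<close> with almost determined neighbourhood. Once no such \<open>y\<close> meets
  both other common neighbours, it is adjacent to the private neighbour \<open>v\<close> and to some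
  \<open>a'\<close>; repeating this with \<open>a'\<close> gives \<open>y'\<close>, and
  \<open>v\<close>, \<open>y\<close>, \<open>y'\<close> form a triangle.\<close>

lemma no_three_common_nbrs: "card (N u \<inter> N z) \<noteq> 3"
proof
  assume c3: "card (N u \<inter> N z) = 3"
  define cfg where "cfg u v z b S \<longleftrightarrow> card S = 3 \<and> N u = insert v S \<and> N z = insert b S
      \<and> v \<notin> S \<and> b \<notin> S \<and> v \<noteq> b" for u v z b S
  have sym: "cfg z b u v S" if "cfg u v z b S" for u v z b S
    using that unfolding cfg_def by auto
  \<comment> \<open>The set \<open>iso u a\<close> has two elements, so one differs from
    \<open>b\<close>, and that one is not adjacent to \<open>z\<close>. Its four neighbours then
    come from five candidates.\<close>
  have M: "\<exists>y. y \<notin> N a \<and> y \<noteq> u \<and> y \<noteq> z \<and> N y \<subseteq> insert v (S - {a}) \<union> (N a - {u, z}) \<and> card (N y) = 4"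
    if C: "cfg u v z b S" and a: "a \<in> S" for u v z b S a
  proof -
    have au: "a \<in> N u" and az: "a \<in> N z" using C a unfolding cfg_def by auto
    have "\<not> iso u a \<subseteq> {b}"
      using iso_ge_2[OF au] card_mono[of "{b}" "iso u a"] by auto
    then obtain y where y: "y \<in> iso u a" "y \<noteq> b" by blast
    note yD = isoD[OF y(1) au]
    have "z \<notin> N y"
    proof
      assume "z \<in> N y"
      then have "y \<in> N z" using nsym by blast
      then show False using C y(2) yD(2) unfolding cfg_def by auto
    qed
    then have "N y \<subseteq> insert v (S - {a}) \<union> (N a - {u, z})"
      using yD(1) C unfolding cfg_def by auto
    moreover have "y \<noteq> z" using yD(3) nsym[OF az] by blast
    ultimately show ?thesis using yD degree_4[OF yD(4)] by blast
  qed
  \<comment> \<open>Applying \<open>M\<close> at \<open>a2\<close> and \<open>a3\<close>, from the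
    \<open>u\<close> side and from the \<open>z\<close> side, gives four vertices of
    \<open>N a1\<close>; since \<open>u\<close> and \<open>z\<close> take two places there, they
    coincide in pairs \<open>p\<close>, \<open>q\<close>. This determines enough of the graph to
    make \<open>iso a2 x\<close> too small.\<close>
  have stepA: False
    if C: "cfg u v z b {a1, a2, a3}" and d: "a1 \<noteq> a2" "a1 \<noteq> a3" "a2 \<noteq> a3"
      and x: "x \<notin> N a1" "x \<in> N a2" "x \<in> N a3" "x \<noteq> u" "x \<noteq> z"
    for u v z b a1 a2 a3 x
  proof -
    have Nu: "N u = {v, a1, a2, a3}" and Nz: "N z = {b, a1, a2, a3}" and vb: "v \<noteq> b"
      and vS: "v \<notin> {a1, a2, a3}" and bS: "b \<notin> {a1, a2, a3}"
      using C unfolding cfg_def by auto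
    have uz: "u \<noteq> z" using Nu Nz vb vS by auto
    have ua: "u \<in> N a1" "u \<in> N a2" "u \<in> N a3" "u \<in> N v" using Nu nsym by blast+
    have za: "z \<in> N a1" "z \<in> N a2" "z \<in> N a3" "z \<in> N b" using Nz nsym by blast+
    have xv: "x \<notin> {v, b, a1, a2, a3}"
      using nbrs_nonadjacent[OF ua(2) x(2)] nbrs_nonadjacent[OF za(2) x(2)] Nu Nz nsym by blast
    have third: "\<exists>r. N a = {u, z, x, r} \<and> r \<noteq> u \<and> r \<noteq> z \<and> r \<noteq> x" if a: "a \<in> {a2, a3}" for a
    proof -
      have xa: "x \<in> N a" "u \<in> N a" "z \<in> N a" using a x ua za by auto
      have "card (N a - {u, z, x}) = 1"
        using degree_4'[OF xa(1)] xa x uz by (subst card_Diff_subset) auto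
      then obtain r where r: "N a - {u, z, x} = {r}" by (auto simp: card_1_singleton_iff)
      then have "N a = {u, z, x, r}" "r \<notin> {u, z, x}" using xa by auto
      then show ?thesis by blast
    qed
    obtain r where r: "N a2 = {u, z, x, r}" "r \<noteq> u" "r \<noteq> z" "r \<noteq> x" using third[of a2] by blast
    obtain r' where r': "N a3 = {u, z, x, r'}" "r' \<noteq> u" "r' \<noteq> z" "r' \<noteq> x" using third[of a3] by blast
    have ra: "r \<in> N a2" "r' \<in> N a3" using r(1) r'(1) by auto
    have rv: "r \<notin> {v, b, a1, a2, a3}"
      using nbrs_nonadjacent[OF ua(2) ra(1)] nbrs_nonadjacent[OF za(2) ra(1)] Nu Nz nsym by blast
    have r'v: "r' \<notin> {v, b, a1, a2, a3}"
      using nbrs_nonadjacent[OF ua(3) ra(2)] nbrs_nonadjacent[OF za(3) ra(2)] Nu Nz nsym by blast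
    \<comment> \<open>Of the five candidates, \<open>a'\<close> and \<open>x\<close> are adjacent,
      so triangle-freeness allows only one of them and the other three are forced.\<close>
    have Y: "\<exists>y. y \<notin> N a \<and> y \<noteq> u \<and> y \<noteq> z \<and> {v, a1, s} \<subseteq> N y \<and> N y \<subseteq> {v, a1, a', x, s} \<and> (a' \<in> N y \<or> x \<in> N y)"
      if C: "cfg u v z b {a1, a, a'}" and d: "a1 \<noteq> a" "a1 \<noteq> a'" "a \<noteq> a'" and Na: "N a = {u, z, x, s}"
        and xa: "x \<in> N a'" for u v z b a a' s
    proof -
      have "a \<in> {a1, a, a'}" by simp
      from M[OF C this] obtain y where y: "y \<notin> N a" "y \<noteq> u" "y \<noteq> z"
        "N y \<subseteq> insert v ({a1, a, a'} - {a}) \<union> (N a - {u, z})" "card (N y) = 4" by blast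
      have sub: "N y \<subseteq> {v, a1, a', x, s}" using y(4) Na d by auto
      have nb: "\<not> (a' \<in> N y \<and> x \<in> N y)" using nbrs_nonadjacent[of a' y x] xa by blast
      have miss: "m \<in> N y" if m: "m \<in> {v, a1, s}" for m
      proof (rule ccontr)
        assume n: "m \<notin> N y"
        have "N y \<subseteq> {v, a1, a', s} - {m} \<or> N y \<subseteq> {v, a1, x, s} - {m}" using sub nb n by blast
        then have "card (N y) \<le> card ({v, a1, a', s} - {m}) \<or> card (N y) \<le> card ({v, a1, x, s} - {m})"
          by (meson card_mono finite.emptyI finite.insertI finite_Diff)
        moreover have "card ({v, a1, k, s} - {m}) \<le> 3" for k
        proof -
          have "card ({v, a1, k, s} - {m}) = card {v, a1, k, s} - 1"
            using m by (intro card_Diff_singleton) auto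
          moreover have "card {v, a1, k, s} \<le> 4" by (simp add: card_insert_if)
          ultimately show ?thesis by linarith
        qed
        note this[of a'] this[of x]
        ultimately show False using y(5) by linarith
      qed
      have "a' \<in> N y \<or> x \<in> N y"
      proof (rule ccontr)
        assume "\<not> ?thesis"
        then have "N y \<subseteq> {v, a1, s}" using sub by blast
        then have "card (N y) \<le> card {v, a1, s}" by (intro card_mono) auto
        then show False using y(5) by (simp add: card_insert_if split: if_splits)
      qed
      then show ?thesis using y miss sub by blast
    qed
    have C': "cfg u v z b {a1, a3, a2}" using C by (simp add: insert_commute)
    obtain p where p: "p \<notin> N a2" "p \<noteq> u" "p \<noteq> z" "{v, a1, r} \<subseteq> N p" "N p \<subseteq> {v, a1, a3, x, r}" "a3 \<in> N p \<or> x \<in> N p"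
      using Y[OF C d r(1) x(3)] by blast
    obtain p' where p': "p' \<notin> N a3" "p' \<noteq> u" "p' \<noteq> z" "{v, a1, r'} \<subseteq> N p'" "N p' \<subseteq> {v, a1, a2, x, r'}" "a2 \<in> N p' \<or> x \<in> N p'"
      using Y[OF C' d(2,1) d(3)[symmetric] r'(1) x(2)] by blast
    have r2: "N a2 = {z, u, x, r}" "N a3 = {z, u, x, r'}" using r(1) r'(1) by auto
    obtain q where q: "q \<notin> N a2" "q \<noteq> z" "q \<noteq> u" "{b, a1, r} \<subseteq> N q" "N q \<subseteq> {b, a1, a3, x, r}" "a3 \<in> N q \<or> x \<in> N q"
      using Y[OF sym[OF C] d r2(1) x(3)] by blast
    obtain q' where q': "q' \<notin> N a3" "q' \<noteq> z" "q' \<noteq> u" "{b, a1, r'} \<subseteq> N q'" "N q' \<subseteq> {b, a1, a2, x, r'}" "a2 \<in> N q' \<or> x \<in> N q'"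
      using Y[OF sym[OF C'] d(2,1) d(3)[symmetric] r2(2) x(2)] by blast
    have "b \<notin> N p" "b \<notin> N p'" using p(5) p'(5) vb bS xv rv r'v by auto
    then have ne: "p \<noteq> q" "p \<noteq> q'" "p' \<noteq> q" "p' \<noteq> q'" using q(4) q'(4) by auto
    have inN: "p \<in> N a1" "p' \<in> N a1" "q \<in> N a1" "q' \<in> N a1"
      using p(4) p'(4) q(4) q'(4) nsym[of a1 p] nsym[of a1 p'] nsym[of a1 q] nsym[of a1 q'] by auto
    have Na1: "N a1 = {u, z, p, q}"
      using inN ua za uz p(2,3) q(2,3) ne by (intro N_eqI) auto
    have pp: "p' = p" and qq: "q' = q" using Na1 inN ne p'(2,3) q'(2,3) by auto
    have "a3 \<notin> N p" "a3 \<notin> N q" using p'(1) q'(1) pp qq nsym by blast+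
    then have xp: "x \<in> N p" "x \<in> N q" using p(6) q(6) by auto
    have rr: "r' = r" using p'(4) p(5) pp r'(4) r'v \<open>a3 \<notin> N p\<close> by auto
    have "a2 \<in> N u" "a3 \<in> N u" "a1 \<in> N u" using Nu by auto
    then have "a1 \<notin> N a2" "a1 \<notin> N a3" using nbrs_nonadjacent by blast+
    moreover have "a1 \<in> N p" "a1 \<in> N q" using p(4) q(4) by auto
    ultimately have apq: "a2 \<noteq> p" "a2 \<noteq> q" "a3 \<noteq> p" "a3 \<noteq> q" by auto
    have "a2 \<in> N x" "a3 \<in> N x" "p \<in> N x" "q \<in> N x"
      using nsym[OF x(2)] nsym[OF x(3)] nsym[OF xp(1)] nsym[OF xp(2)] by auto
    then have Nx: "N x = {a2, a3, p, q}" using d ne apq by (intro N_eqI) auto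
    have "a2 \<in> N r" "a3 \<in> N r" "p \<in> N r" "q \<in> N r"
      using nsym[OF ra(1)] nsym[OF ra(2)] rr p(4) q(4) nsym[of r p] nsym[of r q] by auto
    then have Nr: "N r = {a2, a3, p, q}" using d ne apq by (intro N_eqI) auto
    have xa2: "x \<in> N a2" by (rule x(2))
    \<comment> \<open>The twins \<open>r\<close> of \<open>x\<close> and \<open>a3\<close> of
      \<open>a2\<close> cannot be adjacent to \<open>t\<close>. This forces
      \<open>N t = {u, z, p, q}\<close>, so \<open>t\<close> is a common neighbour of
      \<open>u\<close> and \<open>z\<close>.\<close>
    have "iso a2 x \<subseteq> {a1}"
    proof
      fix t assume t: "t \<in> iso a2 x"
      note tD = isoD[OF t xa2]
      have "N r = N x" "N a3 = N a2" using Nr Nx r(1) r'(1) rr by auto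
      then have "r \<notin> N t" "a3 \<notin> N t" using tD(2,3) nsym[of r t] nsym[of a3 t] by auto
      then have "N t \<subseteq> {u, z, p, q}" using tD(1) r(1) Nx by auto
      moreover have "card {u, z, p, q} \<le> card (N t)"
        using degree_4[OF tD(4)] by (simp add: card_insert_if)
      ultimately have "N t = {u, z, p, q}" by (intro card_seteq) auto
      then have "t \<in> N u" "t \<in> N z" using nsym[of u t] nsym[of z t] by auto
      then have "t \<in> {a1, a2, a3}" using Nu Nz vb vS by auto
      then show "t \<in> {a1}" using tD(3,6) Nx by auto
    qed
    then have "card (iso a2 x) \<le> 1" using card_mono[of "{a1}" "iso a2 x"] by simp
    then show False using iso_ge_2[OF xa2] by linarith
  qed
  have stepB: "\<exists>y. v \<in> N y \<and> N a - {u, z} \<subseteq> N y \<and> (\<exists>a'\<in>S. a' \<in> N y) \<and> y \<noteq> u \<and> y \<noteq> z"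
    if C: "cfg u v z b S" and a: "a \<in> S" for u v z b S a
  proof -
    have S3: "card S = 3" using C unfolding cfg_def by blast
    obtain a' a'' where S: "S = {a, a', a''}" "a \<noteq> a'" "a \<noteq> a''" "a' \<noteq> a''"
      using S3 a by (rule card_3_memE)
    obtain y where y: "y \<notin> N a" "y \<noteq> u" "y \<noteq> z"
      "N y \<subseteq> insert v (S - {a}) \<union> (N a - {u, z})" "card (N y) = 4" using M[OF C a] by blast
    have Nu: "N u = insert v S" and Nz: "N z = insert b S" and vS: "v \<notin> S" "v \<noteq> b" using C unfolding cfg_def by auto
    have "u \<noteq> z" using Nu Nz vS by auto
    moreover have uzN: "u \<in> N a" "z \<in> N a" using Nu Nz a nsym by blast+
    ultimately have c2: "card (N a - {u, z}) = 2"
      using degree_4'[OF uzN(1)] by (subst card_Diff_subset) auto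
    have "\<not> (a' \<in> N y \<and> a'' \<in> N y)"
    proof
      assume "a' \<in> N y \<and> a'' \<in> N y"
      then have "y \<in> N a'" "y \<in> N a''" using nsym by blast+
      then show False using stepA[of u v z b a a' a'' y] C S y by blast
    qed
    then obtain m m' where m: "m \<notin> N y" "{m, m'} = {a', a''}" by blast
    then have sub: "N y \<subseteq> insert v {m'} \<union> (N a - {u, z})" using y(4) S by auto
    have "card (insert v {m'} \<union> (N a - {u, z})) \<le> card (insert v {m'}) + card (N a - {u, z})"
      by (rule card_Un_le)
    also have "\<dots> \<le> 4" using c2 by (simp add: card_insert_if)
    finally have "N y = insert v {m'} \<union> (N a - {u, z})"
      using y(5) sub nfin by (intro card_seteq) auto
    moreover have "m' \<in> S" using m(2) S(1) by blast
    ultimately show ?thesis using y by blast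
  qed
  have nb: "N u \<inter> N z \<noteq> {}" using c3 by auto
  then have u4: "card (N u) = 4" "card (N z) = 4" using degree_4' by blast+
  define S where "S = N u \<inter> N z"
  have "card (N u - S) = 1" "card (N z - S) = 1"
    using u4 c3 nfin unfolding S_def by (simp_all add: card_Diff_subset_Int Int_commute Int_left_commute)
  then obtain v b where vb: "N u - S = {v}" "N z - S = {b}" by (auto simp: card_1_singleton_iff)
  have C: "cfg u v z b S"
  proof -
    have "v \<in> N u" "v \<notin> S" "b \<in> N z" "b \<notin> S" using vb by blast+
    moreover have "S \<subseteq> N u" "S \<subseteq> N z" unfolding S_def by auto
    moreover have "v \<noteq> b" using calculation unfolding S_def by blast
    moreover have "N u = insert v S" using vb(1) \<open>S \<subseteq> N u\<close> by blast
    moreover have "N z = insert b S" using vb(2) \<open>S \<subseteq> N z\<close> by blast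
    ultimately show ?thesis using c3 unfolding cfg_def S_def by blast
  qed
  obtain a where a: "a \<in> S" using nb unfolding S_def by blast
  obtain y a' where y: "v \<in> N y" "a' \<in> S" "a' \<in> N y" "y \<noteq> u" "y \<noteq> z" using stepB[OF C a] by blast
  obtain y' where y': "v \<in> N y'" "N a' - {u, z} \<subseteq> N y'" using stepB[OF C y(2)] by blast
  have "y \<in> N y'" using y y' nsym by blast
  then show False using nbrs_nonadjacent[of v y' y] y' y(1) nsym by blast
qed

text \<open>The four neighbours of \<open>z\<close> split between two sets of size three, and
  \<open>no_three_common_nbrs\<close> excludes the split 3 + 1.\<close>

lemma iso_two_two:
  assumes a: "a \<in> N w" and z: "z \<in> iso w a"
  shows "card (N z \<inter> N w) = 2" "card (N z \<inter> N a) = 2" "N z \<inter> N w \<subseteq> N w - {a}" "N z \<inter> N a \<subseteq> N a - {w}"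
    "N z = (N z \<inter> N w) \<union> (N z \<inter> N a)"
proof -
  note zD = isoD[OF z a]
  show s: "N z \<inter> N w \<subseteq> N w - {a}" "N z \<inter> N a \<subseteq> N a - {w}"
    "N z = (N z \<inter> N w) \<union> (N z \<inter> N a)" using zD(1) by auto
  have "card ((N z \<inter> N w) \<union> (N z \<inter> N a)) = card (N z \<inter> N w) + card (N z \<inter> N a)"
    using triangle_free[OF a] nfin by (intro card_Un_disjoint) auto
  then have 4: "card (N z \<inter> N w) + card (N z \<inter> N a) = 4" using s(3) degree_4[OF zD(4)] by simp
  have "card (N z \<inter> N w) \<le> card (N w - {a})" "card (N z \<inter> N a) \<le> card (N a - {w})"
    using s nfin by (auto intro: card_mono)
  moreover have "card (N w - {a}) \<le> 3" "card (N a - {w}) \<le> 3"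
    using card_diff_nbr a nsym by blast+
  ultimately show "card (N z \<inter> N w) = 2" "card (N z \<inter> N a) = 2"
    using 4 no_three_common_nbrs[of z w] no_three_common_nbrs[of z a] by linarith+
qed

lemma twins_of_three_common:
  assumes "p \<in> N x \<inter> N y" "q \<in> N x \<inter> N y" "r \<in> N x \<inter> N y" "p \<noteq> q" "p \<noteq> r" "q \<noteq> r"
  shows "N x = N y"
proof -
  have "{p, q, r} \<subseteq> N x \<inter> N y" using assms by blast
  then have "3 \<le> card (N x \<inter> N y)" using card_mono[of "N x \<inter> N y" "{p, q, r}"] nfin assms(4-) by simp
  then have "4 \<le> card (N x \<inter> N y)" using no_three_common_nbrs[of x y] by linarith
  then have "N x \<inter> N y = N x" "N x \<inter> N y = N y"
    using ncard nfin by (intro card_seteq; auto intro: le_trans)+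
  then show ?thesis by simp
qed

text \<open>A vertex of \<open>iso w c\<close> has two neighbours among \<open>z1\<close>,
  \<open>z2\<close>, \<open>c'\<close>. Adjacency to \<open>z1\<close> confines it to
  \<open>{q1, q2}\<close>, adjacency to \<open>z2\<close> to \<open>{q2, q3}\<close>, and
  \<open>q2\<close> has too few neighbours in \<open>N w\<close>. Hence
  \<open>iso w c = {q1, q3}\<close>. In \<open>iso_twins\<close> the lemma is applied a second time
  with \<open>w\<close> and \<open>a\<close> exchanged.\<close>

lemma crossing_half:
  assumes Nw: "N w = {a, b, c, d}" and Na: "N a = {w, q1, q2, q3}"
    and Nz1: "N z1 = {b, c, q1, q2}" and Nz2: "N z2 = {c, d, q2, q3}"
    and dw: "distinct [a, b, c, d]" and da: "distinct [w, q1, q2, q3]" and dz: "distinct [w, a, z1, z2]"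
  shows "\<exists>c'. N c = {w, z1, z2, c'} \<and> c' \<noteq> w \<and> c' \<noteq> z1 \<and> c' \<noteq> z2
    \<and> N q1 = {a, z1, c', d} \<and> N q3 = {a, z2, c', b}"
proof -
  have nw: "w \<in> N a" "w \<in> N b" "w \<in> N c" "w \<in> N d" using Nw nsym[of _ w] by auto
  have n1: "z1 \<in> N b" "z1 \<in> N c" "z1 \<in> N q1" "z1 \<in> N q2" using Nz1 nsym[of _ z1] by auto
  have n2: "z2 \<in> N c" "z2 \<in> N d" "z2 \<in> N q2" "z2 \<in> N q3" using Nz2 nsym[of _ z2] by auto
  have na: "a \<in> N q1" "a \<in> N q2" "a \<in> N q3" using Na nsym[of _ a] by auto
  have "card (N c - {w, z1, z2}) = 1"
    using degree_4'[OF nw(3)] nw n1 n2 dz by (subst card_Diff_subset) auto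
  then obtain c' where "N c - {w, z1, z2} = {c'}" by (auto simp: card_1_singleton_iff)
  then have Nc: "N c = {w, z1, z2, c'}" and c': "c' \<noteq> w" "c' \<noteq> z1" "c' \<noteq> z2" using nw n1 n2 by auto
  have cw: "c \<in> N w" using Nw by simp
  have bq: "b \<notin> N q1" "b \<notin> N q2" "d \<notin> N q2" "d \<notin> N q3"
    using nbrs_nonadjacent[of q1 z1 b] nbrs_nonadjacent[of q2 z1 b] nbrs_nonadjacent[of q2 z2 d]
      nbrs_nonadjacent[of q3 z2 d] Nz1 Nz2 by auto
  have q2: "q2 \<notin> iso w c"
  proof
    assume q2: "q2 \<in> iso w c"
    then have "N q2 \<inter> N w \<subseteq> {a}" using Nw bq isoD(1)[OF q2 cw] by auto
    then have "card (N q2 \<inter> N w) \<le> 1" using card_mono[of "{a}" "N q2 \<inter> N w"] by simp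
    then show False using iso_two_two(1)[OF cw q2] by simp
  qed
  have mem: "c' \<in> N y \<and> y \<in> {q1, q3}" if y: "y \<in> iso w c" for y
  proof -
    note yD = isoD[OF y cw]
    have sub: "N y \<inter> N c \<subseteq> {z1, z2, c'}" using iso_two_two(4)[OF cw y] Nc by auto
    have y1: "y \<in> {q1, q2}" if "z1 \<in> N y"
      using nsym[OF that] Nz1 yD(2,6) Nw by auto
    have y2: "y \<in> {q2, q3}" if "z2 \<in> N y"
      using nsym[OF that] Nz2 yD(2,6) Nw by auto
    have "y \<noteq> q2" using q2 y by blast
    then have nb: "\<not> (z1 \<in> N y \<and> z2 \<in> N y)" using y1 y2 da by auto
    have ge: "\<not> N y \<inter> N c \<subseteq> {m}" for m
      using iso_two_two(2)[OF cw y] card_mono[of "{m}" "N y \<inter> N c"] by auto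
    have "c' \<in> N y" "z1 \<in> N y \<or> z2 \<in> N y"
      using ge[of z1] ge[of z2] ge[of c'] sub nb by blast+
    then show ?thesis using y1 y2 \<open>y \<noteq> q2\<close> by blast
  qed
  have "iso w c \<subseteq> {q1, q3}" using mem by blast
  then have I: "iso w c = {q1, q3}"
    using iso_ge_2[OF cw] by (intro card_seteq) (auto simp: card_insert_if)
  then have I1: "q1 \<in> iso w c" "q3 \<in> iso w c" by auto
  have c'N: "c' \<in> N q1" "c' \<in> N q3" using mem I by auto
  have cn: "c \<notin> N q1" "c \<notin> N q3" using isoD(1)[OF I1(1) cw] isoD(1)[OF I1(2) cw] by auto
  have ge: "\<not> N y \<inter> N w \<subseteq> {a}" if "y \<in> iso w c" for y
    using iso_two_two(1)[OF cw that] card_mono[of "{a}" "N y \<inter> N w"] by auto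
  have "d \<in> N q1" using ge[OF I1(1)] Nw bq cn by auto
  moreover have "b \<in> N q3" using ge[OF I1(2)] Nw bq cn by auto
  moreover have "c' \<notin> N w" using nbrs_nonadjacent[of w c c'] nw(3) Nc by auto
  then have "c' \<noteq> a" "c' \<noteq> b" "c' \<noteq> d" using Nw by auto
  moreover have "z1 \<notin> N w" "z2 \<notin> N w"
    using nbrs_nonadjacent[of w c z1] nbrs_nonadjacent[of w c z2] nw(3) n1 n2 by auto
  then have "z1 \<noteq> d" "z2 \<noteq> b" using Nw by auto
  ultimately have "N q1 = {a, z1, c', d}" "N q3 = {a, z2, c', b}"
    using na n1 n2 c'N c' dw dz by (intro N_eqI; auto)+
  then show ?thesis using Nc c' by blast
qed

text \<open>If \<open>z1\<close> and \<open>z2\<close> agreed on \<open>N w\<close> or on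
  \<open>N a\<close>, they would have two common neighbours there and, as 2-subsets of a 3-set meet,
  a third on the other side, making them twins. So they cross on both sides, and the two uses of
  \<open>crossing_half\<close> determine enough neighbourhoods to show
  \<open>iso w b = {}\<close>.\<close>

lemma iso_twins:
  assumes a: "a \<in> N w" and z: "z1 \<in> iso w a" "z2 \<in> iso w a"
  shows "N z1 = N z2"
proof (rule ccontr)
  assume ne: "N z1 \<noteq> N z2"
  note t1 = iso_two_two[OF a z(1)] and t2 = iso_two_two[OF a z(2)]
  note D1 = isoD[OF z(1) a] and D2 = isoD[OF z(2) a]
  have wa: "w \<in> N a" using a nsym by blast
  have c3: "card (N w - {a}) = 3" "card (N a - {w}) = 3"
    using degree_4'[OF a] degree_4'[OF wa] a wa by simp_all
  have meet: "\<exists>x. x \<in> X \<inter> Y" if "card Z = 3" "X \<subseteq> Z" "Y \<subseteq> Z" "card X = 2" "card Y = 2" for X Y Z :: "'a set"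
  proof (rule ccontr)
    assume "\<not> ?thesis"
    then have "X \<inter> Y = {}" by blast
    moreover have fin: "finite Z" using that(1) card.infinite by fastforce
    ultimately have "card (X \<union> Y) = 4" using that finite_subset[OF _ fin] by (subst card_Un_disjoint) auto
    then show False using card_mono[OF fin, of "X \<union> Y"] that by simp
  qed
  have disj: "N w \<inter> N a = {}" by (rule triangle_free[OF a])
  have P: "N z1 \<inter> N w \<noteq> N z2 \<inter> N w"
  proof
    assume eq: "N z1 \<inter> N w = N z2 \<inter> N w"
    obtain p p' where p: "N z1 \<inter> N w = {p, p'}" "p \<noteq> p'" using t1(1) by (auto simp: card_2_iff)
    obtain q where q: "q \<in> (N z1 \<inter> N a) \<inter> (N z2 \<inter> N a)" using meet[OF c3(2) t1(4) t2(4) t1(2) t2(2)] by blast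
    have pm: "p \<in> N z1 \<inter> N w" "p' \<in> N z1 \<inter> N w" using p by auto
    then have "p \<in> N z2 \<inter> N w" "p' \<in> N z2 \<inter> N w" using eq by auto
    then show False using twins_of_three_common[of p z1 z2 p' q] p(2) pm q ne disj by blast
  qed
  have Q: "N z1 \<inter> N a \<noteq> N z2 \<inter> N a"
  proof
    assume eq: "N z1 \<inter> N a = N z2 \<inter> N a"
    obtain p p' where p: "N z1 \<inter> N a = {p, p'}" "p \<noteq> p'" using t1(2) by (auto simp: card_2_iff)
    obtain q where q: "q \<in> (N z1 \<inter> N w) \<inter> (N z2 \<inter> N w)" using meet[OF c3(1) t1(3) t2(3) t1(1) t2(1)] by blast
    have pm: "p \<in> N z1 \<inter> N a" "p' \<in> N z1 \<inter> N a" using p by auto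
    then have "p \<in> N z2 \<inter> N a" "p' \<in> N z2 \<inter> N a" using eq by auto
    then show False using twins_of_three_common[of p z1 z2 p' q] p(2) pm q ne disj by blast
  qed
  obtain b c d where bcd: "N z1 \<inter> N w = {b, c}" "N z2 \<inter> N w = {c, d}" "N w - {a} = {b, c, d}" "b \<noteq> c" "b \<noteq> d" "c \<noteq> d"
    using two_subsets_of_3[OF c3(1) t1(3) t2(3) t1(1) t2(1) P] by blast
  obtain q1 q2 q3 where q: "N z1 \<inter> N a = {q1, q2}" "N z2 \<inter> N a = {q2, q3}" "N a - {w} = {q1, q2, q3}" "q1 \<noteq> q2" "q1 \<noteq> q3" "q2 \<noteq> q3"
    using two_subsets_of_3[OF c3(2) t1(4) t2(4) t1(2) t2(2) Q] by blast
  have Nw: "N w = {a, b, c, d}" and dw: "distinct [a, b, c, d]" using bcd a by auto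
  have Na: "N a = {w, q1, q2, q3}" and da: "distinct [w, q1, q2, q3]" using q wa by auto
  have Nz1: "N z1 = {b, c, q1, q2}" using t1(5) bcd(1) q(1) by auto
  have Nz2: "N z2 = {c, d, q2, q3}" using t2(5) bcd(2) q(2) by auto
  have "w \<noteq> a" "z1 \<noteq> z2" using a nirr ne by auto
  then have dz: "distinct [w, a, z1, z2]" "distinct [a, w, z1, z2]" using D1 D2 by auto
  obtain c' where Nc: "N c = {w, z1, z2, c'}" "c' \<noteq> w" "c' \<noteq> z1" "c' \<noteq> z2" "N q1 = {a, z1, c', d}" "N q3 = {a, z2, c', b}"
    using crossing_half[OF Nw Na Nz1 Nz2 dw da dz(1)] by blast
  have Nz1': "N z1 = {q1, q2, b, c}" and Nz2': "N z2 = {q2, q3, c, d}" using Nz1 Nz2 by auto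
  obtain q' where Nq: "N q2 = {a, z1, z2, q'}" "q' \<noteq> a" "q' \<noteq> z1" "q' \<noteq> z2" "N b = {w, z1, q', q3}" "N d = {w, z2, q', q1}"
    using crossing_half[OF Na Nw Nz1' Nz2' da dw dz(2)] by blast
  have bw: "b \<in> N w" using Nw by simp
  have mc: "c \<in> N c'" "q1 \<in> N c'" "q3 \<in> N c'" using Nc nsym[of c' c] nsym[of c' q1] nsym[of c' q3] by auto
  have mq: "b \<in> N q'" "d \<in> N q'" using Nq nsym[of q' b] nsym[of q' d] by auto
  have bq: "N w \<inter> N a = {}" by (rule disj)
  have ne1: "c' \<noteq> q'"
  proof
    assume "c' = q'"
    then have "{b, c, d, q1, q3} \<subseteq> N c'" using mc mq by simp
    moreover have "card {b, c, d, q1, q3} = 5" using Nw Na bq dw da by auto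
    ultimately show False using card_mono[OF nfin, of "{b, c, d, q1, q3}" c'] ncard[of c'] by simp
  qed
  have c'a: "c' \<notin> N a" using nbrs_nonadjacent[of q1 c' a] nbrs_nonadjacent[of a q1 c'] Nc by auto
  have c'w: "c' \<notin> N w" using nbrs_nonadjacent[of w c c'] Nc by auto
  have q'a: "q' \<notin> N a" using nbrs_nonadjacent[of a q2 q'] Nq by auto
  have zw: "z1 \<notin> N a" "z2 \<notin> N a" "z1 \<notin> N w" "z2 \<notin> N w" using D1 D2 by auto
  have c'b: "c' \<notin> N b"
  proof
    assume "c' \<in> N b"
    then have "c' = q3" using Nq(5) Nc ne1 by auto
    then show False using Nc(6) nirr by blast
  qed
  have q2n: "q2 \<notin> N w \<union> N b"
  proof -
    have "q2 \<noteq> q'" using Nq(1) nirr[of q2] by auto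
    moreover have "q2 \<noteq> z1" using zw Na by auto
    ultimately have "q2 \<notin> N b" using Nq(5) da by auto
    then show ?thesis using bq Na by auto
  qed
  \<comment> \<open>A vertex here needs two neighbours among \<open>a\<close>, \<open>c\<close>,
    \<open>d\<close>; each of the three pairs is excluded by the neighbourhoods just found.\<close>
  have "iso w b = {}"
  proof (rule ccontr)
    assume "iso w b \<noteq> {}"
    then obtain y where y: "y \<in> iso w b" by blast
    note yD = isoD[OF y bw]
    have sub: "N y \<inter> N w \<subseteq> {a, c, d}" using iso_two_two(3)[OF bw y] Nw by auto
    have ge: "\<not> N y \<inter> N w \<subseteq> {m}" for m
      using iso_two_two(1)[OF bw y] card_mono[of "{m}" "N y \<inter> N w"] by auto
    have "a \<in> N y \<and> c \<in> N y \<or> a \<in> N y \<and> d \<in> N y \<or> c \<in> N y \<and> d \<in> N y"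
      using sub ge[of a] ge[of c] ge[of d] by blast
    moreover have "\<not> (a \<in> N y \<and> c \<in> N y)"
    proof
      assume "a \<in> N y \<and> c \<in> N y"
      then have "y \<in> N a" "y \<in> N c" using nsym[of a y] nsym[of c y] by auto
      then show False using Nc(1) yD(5) zw c'a by auto
    qed
    moreover have "\<not> (a \<in> N y \<and> d \<in> N y)"
    proof
      assume "a \<in> N y \<and> d \<in> N y"
      then have "y \<in> N a" "y \<in> N d" using nsym[of a y] nsym[of d y] by auto
      then have "y = q1" using Nq(6) yD(5) zw q'a by auto
      then have "c' \<in> N w \<union> N b" using yD(1) Nc(5) by auto
      then show False using c'w c'b by blast
    qed
    moreover have "\<not> (c \<in> N y \<and> d \<in> N y)"
    proof
      assume "c \<in> N y \<and> d \<in> N y"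
      then have "y \<in> N c" "y \<in> N d" using nsym[of c y] nsym[of d y] by auto
      moreover have "z1 \<noteq> q1" "c' \<noteq> q1" using zw Na c'a by auto
      ultimately have "y = z2" using Nq(3,6) Nc(1) yD(5) ne1 dz by auto
      then show False using q2n yD(1) Nz2 by auto
    qed
    ultimately show False by blast
  qed
  then show False using iso_ge_2[OF bw] by simp
qed

text \<open>Two twins in \<open>iso w a\<close> make their common neighbours in \<open>N w\<close>
  twins of each other, and likewise those in \<open>N a\<close>, since each pair shares three
  neighbours. The fourth neighbours \<open>e\<close> and \<open>f\<close> supply the missing
  partners of \<open>w\<close> and \<open>a\<close>.\<close>

lemma C25_configuration:
  assumes a: "a \<in> N w"
  obtains w' b b' z z' q q' a' where
    "distinct [w, w', b, b', z, z', q, q', a, a']"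
    "N w = {a, a', b, b'}" "N w' = {a, a', b, b'}"
    "N b = {w, w', z, z'}" "N b' = {w, w', z, z'}"
    "N z = {b, b', q, q'}" "N z' = {b, b', q, q'}"
    "N q = {z, z', a, a'}" "N q' = {z, z', a, a'}"
    "N a = {q, q', w, w'}" "N a' = {q, q', w, w'}"
proof -
  have "card (iso w a) \<noteq> 0" "card (iso w a) \<noteq> 1" using iso_ge_2[OF a] by auto
  then obtain z1 z2 where z: "z1 \<in> iso w a" "z2 \<in> iso w a" "z1 \<noteq> z2"
    by (metis card_1_singleton_iff card.empty is_singletonI' is_singleton_altdef ex_in_conv)
  note t = iso_two_two[OF a z(1)]
  note D1 = isoD[OF z(1) a] and D2 = isoD[OF z(2) a]
  have Nz: "N z2 = N z1" using iso_twins[OF a z(2,1)] .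
  obtain b c where b: "N z1 \<inter> N w = {b, c}" "b \<noteq> c" using t(1) by (auto simp: card_2_iff)
  obtain q q' where q: "N z1 \<inter> N a = {q, q'}" "q \<noteq> q'" using t(2) by (auto simp: card_2_iff)
  have disj: "N w \<inter> N a = {}" by (rule triangle_free[OF a])
  have bm: "b \<in> N z1" "c \<in> N z1" "b \<in> N w" "c \<in> N w" using b by auto
  have qm: "q \<in> N z1" "q' \<in> N z1" "q \<in> N a" "q' \<in> N a" using q by auto
  have Nz1: "N z1 = {b, c, q, q'}" using t(5) b q by auto
  have n: "w \<in> N b" "w \<in> N c" "z1 \<in> N b" "z1 \<in> N c" "z2 \<in> N b" "z2 \<in> N c"
    "a \<in> N q" "a \<in> N q'" "z1 \<in> N q" "z1 \<in> N q'" "z2 \<in> N q" "z2 \<in> N q'"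
    using nsym[OF bm(1)] nsym[OF bm(2)] nsym[OF bm(3)] nsym[OF bm(4)]
      nsym[OF qm(1)] nsym[OF qm(2)] nsym[OF qm(3)] nsym[OF qm(4)]
      nsym[of b z2] nsym[of c z2] nsym[of q z2] nsym[of q' z2] bm qm Nz by auto
  have zne: "z1 \<noteq> w" "z2 \<noteq> w" "z1 \<noteq> a" "z2 \<noteq> a" using D1 D2 by auto
  have bc: "N c = N b" using n zne z(3) by (intro twins_of_three_common[of w c b z1 z2]) auto
  have qq: "N q' = N q" using n zne z(3) by (intro twins_of_three_common[of a q' q z1 z2]) auto
  have ex4: "\<exists>e. N x = {p, r, s, e} \<and> e \<noteq> p \<and> e \<noteq> r \<and> e \<noteq> s"
    if "p \<in> N x" "r \<in> N x" "s \<in> N x" "p \<noteq> r" "p \<noteq> s" "r \<noteq> s" for x p r s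
  proof -
    have "card (N x - {p, r, s}) = 1"
      using degree_4'[OF that(1)] that by (subst card_Diff_subset) auto
    then obtain e where "N x - {p, r, s} = {e}" by (auto simp: card_1_singleton_iff)
    then have "N x = {p, r, s, e}" "e \<notin> {p, r, s}" using that by auto
    then show ?thesis by blast
  qed
  obtain e where e: "N b = {w, z1, z2, e}" "e \<noteq> w" "e \<noteq> z1" "e \<noteq> z2"
    using ex4[of w b z1 z2] n zne z(3) by blast
  obtain f where f: "N q = {a, z1, z2, f}" "f \<noteq> a" "f \<noteq> z1" "f \<noteq> z2"
    using ex4[of a q z1 z2] n zne z(3) by blast
  have zb: "z1 \<in> N b" by (rule n(3))
  \<comment> \<open>The twins \<open>z2\<close> of \<open>z1\<close> and \<open>c\<close> of
    \<open>b\<close> cannot be adjacent to \<open>t\<close>, so only four candidates remain for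
    \<open>N t\<close>. As \<open>iso b z1\<close> has two elements, both \<open>a\<close> and
    \<open>f\<close> occur.\<close>
  have It: "N t = {w, e, q, q'} \<and> t \<in> {a, f}" if t: "t \<in> iso b z1" for t
  proof -
    note tD = isoD[OF t zb]
    have "z2 \<notin> N t" using tD(3) Nz nsym[of z2 t] by auto
    moreover have "c \<notin> N t" using tD(2) bc nsym[of c t] by auto
    ultimately have "N t \<subseteq> {w, e, q, q'}" using tD(1) e(1) Nz1 by auto
    moreover have "card {w, e, q, q'} \<le> card (N t)" using degree_4[OF tD(4)] by (simp add: card_insert_if)
    ultimately have Nt: "N t = {w, e, q, q'}" by (intro card_seteq) auto
    then have "q \<in> N t" by simp
    then have "t \<in> {a, f}" using nsym[of q t] f(1) tD(6) tD(2) e(1) by auto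
    then show ?thesis using Nt by blast
  qed
  have "iso b z1 \<subseteq> {a, f}" using It by blast
  then have "iso b z1 = {a, f}"
    using iso_ge_2[OF zb] by (intro card_seteq) (auto simp: card_insert_if)
  then have Na: "N a = {w, e, q, q'}" and Nf: "N f = {w, e, q, q'}" using It by auto
  have "w \<in> N f" "e \<in> N f" "e \<in> N a" using Na Nf by auto
  note fw = this[THEN nsym]
  have "b \<notin> N a" "c \<notin> N a" using bm disj by auto
  have fb: "f \<noteq> b" "f \<noteq> c" using nbrs_nonadjacent[of q z1 b] nbrs_nonadjacent[of q z1 c] f(1) bm qm by auto
  have ab: "a \<noteq> b" "a \<noteq> c" using t(3) b by auto
  have Nw: "N w = {a, f, b, c}" using a fw(1) bm f(2) ab fb b(2) by (intro N_eqI) auto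
  have "e \<in> N b" "e \<in> N c" using e(1) bc by auto
  then have "b \<in> N e" "c \<in> N e" using nsym by blast+
  then have Ne: "N e = {a, f, b, c}" using fw f(2) ab fb b(2) by (intro N_eqI) auto
  have "w \<in> N a" "e \<in> N a" "q \<in> N a" "q' \<in> N a" "a \<in> N w" "f \<in> N w" "b \<in> N w" "c \<in> N w"
    "z1 \<notin> N a" "z2 \<notin> N a" "z1 \<notin> N w" "z2 \<notin> N w"
    using Na Nw D1 D2 by auto
  moreover have "w \<notin> N z1" "e \<notin> N z1" "a \<notin> N z1" "f \<notin> N z1"
    using calculation(9,11) nsym[of w z1] nsym[of e z1] nsym[of a z1] nsym[of f z1] Na Nf Nw Ne by auto
  moreover have "x \<noteq> y" if "x \<in> N y" for x y using that nirr by blast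
  note this[of w b] this[of w c] this[of e b] this[of e c] this[of a w] this[of f w] this[of a e] this[of f e]
    this[of q a] this[of q' a] this[of q f] this[of q' f] this[of b z1] this[of c z1] this[of q z1] this[of q' z1]
    this[of b z2] this[of c z2] this[of q z2] this[of q' z2]
  moreover have "x \<noteq> y" if "x \<in> N w" "y \<in> N a" for x y using that disj by blast
  note this[of b q] this[of c q] this[of b q'] this[of c q']
  ultimately have dist: "distinct [w, e, b, c, z1, z2, q, q', a, f]"
    using Ne Nf Nz1 Nz e bc bm qm b(2) q(2) z(3) f(2) by auto
  show ?thesis
  proof (rule that[OF dist Nw Ne])
    show "N b = {w, e, z1, z2}" "N c = {w, e, z1, z2}" using e(1) bc by auto
    show "N z1 = {b, c, q, q'}" "N z2 = {b, c, q, q'}" using Nz1 Nz by auto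
    show "N q = {z1, z2, a, f}" "N q' = {z1, z2, a, f}" using f(1) qq by auto
    show "N a = {q, q', w, e}" "N f = {q, q', w, e}" using Na Nf by auto
  qed
qed

end

subsection \<open>Induction over induced subgraphs\<close>

text \<open>The neighbourhood in the subgraph induced by \<open>W\<close>, made total by the value
  \<open>{}\<close> outside \<open>W\<close> to fit the locale.\<close>

definition nbrs :: "'a set set \<Rightarrow> 'a set \<Rightarrow> 'a \<Rightarrow> 'a set" where
  "nbrs E W v = (if v \<in> W then {u \<in> W. {u, v} \<in> E} else {})"

lemma nbrs_subset: "nbrs E W v \<subseteq> W"
  by (auto simp: nbrs_def)

lemma nbrs_mono: "W \<subseteq> W' \<Longrightarrow> nbrs E W v \<subseteq> nbrs E W' v"
  by (auto simp: nbrs_def)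

lemma subquartic_nbrs:
  assumes G: "finite_simple_graph V E" and deg: "max_degree V E \<le> 4" and W: "W \<subseteq> V"
  shows "subquartic (nbrs E W)"
proof
  have finV: "finite V" and E: "\<And>e. e \<in> E \<Longrightarrow> e \<subseteq> V \<and> card e = 2"
    using G unfolding finite_simple_graph_def by auto
  have finE: "finite E" by (rule finite_subset[of _ "Pow V"]) (use E finV in auto)
  show "x \<in> nbrs E W y \<Longrightarrow> y \<in> nbrs E W x" for x y
    by (auto simp: nbrs_def insert_commute split: if_splits)
  show "x \<notin> nbrs E W x" for x using E[of "{x}"] by (auto simp: nbrs_def)
  show fin: "finite (nbrs E W x)" for x
    using finite_subset[OF nbrs_subset finite_subset[OF W finV]] .
  show "card (nbrs E W x) \<le> 4" for x
  proof (cases "x \<in> W")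
    case True
    have inj: "inj_on (\<lambda>u. {u, x}) (nbrs E W x)" by (auto simp: inj_on_def doubleton_eq_iff)
    have "card (nbrs E W x) = card ((\<lambda>u. {u, x}) ` nbrs E W x)" using inj by (simp add: card_image)
    also have "\<dots> \<le> card {e \<in> E. x \<in> e}"
      using finE by (intro card_mono) (auto simp: nbrs_def split: if_splits)
    also have "\<dots> \<le> Max (degree E ` V)"
      using True W finV unfolding degree_def[symmetric] by (intro Max_ge) auto
    finally show ?thesis using deg unfolding max_degree_def by linarith
  qed (simp add: nbrs_def)
qed

text \<open>Vertex-disjointness and absence of joining edges, the two requirements on an induced
  matching, in one condition that is easy to extend by an edge.\<close>

definition separated :: "'a set set \<Rightarrow> 'a set set \<Rightarrow> bool" where
  "separated E M \<longleftrightarrow> (\<forall>e\<in>M. \<forall>f\<in>M. e \<noteq> f \<longrightarrow> (\<forall>x\<in>e. \<forall>y\<in>f. x \<noteq> y \<and> {x, y} \<notin> E))"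

text \<open>Counting only non-isolated vertices lets those isolated by a deletion drop out of the
  balance. Each step gains one edge and loses at most nine counted vertices, and
  \<open>\<Union>M \<subseteq> W\<close> keeps the edges chosen in the remainder away from the
  deleted neighbourhoods.\<close>

lemma separated_matching_exists:
  assumes G: "finite_simple_graph V E" and deg: "max_degree V E \<le> 4"
    and noC: "\<And>W w. W \<subseteq> V \<Longrightarrow> all_edges_bad (nbrs E W) \<Longrightarrow> nbrs E W w = {}"
    and W: "W \<subseteq> V"
  shows "\<exists>M. finite M \<and> M \<subseteq> E \<and> \<Union>M \<subseteq> W \<and> separated E M \<and> card {v \<in> W. nbrs E W v \<noteq> {}} \<le> 9 * card M"
proof -
  have "finite V" using G unfolding finite_simple_graph_def by blast
  then have "finite W" using W finite_subset by blast
  then show ?thesis using W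
  proof (induction W rule: finite_psubset_induct)
    case (psubset W)
    show ?case
    proof (cases "\<exists>w. nbrs E W w \<noteq> {}")
      case False
      then show ?thesis by (intro exI[of _ "{}"]) (simp add: separated_def)
    next
      case True
      interpret subquartic "nbrs E W" using subquartic_nbrs[OF G deg psubset.prems] .
      have "\<not> all_edges_bad (nbrs E W)" using noC[OF psubset.prems] True by blast
      then have "\<not> all_edges_bad_axioms (nbrs E W)" using subquartic_axioms by (simp add: all_edges_bad_def)
      then obtain x y where xy: "y \<in> nbrs E W x"
        and "\<not> 10 \<le> card (nbrs E W x \<union> nbrs E W y) + card (iso x y)"
        unfolding all_edges_bad_axioms_def by blast
      then have small: "card (nbrs E W x \<union> nbrs E W y) + card (iso x y) \<le> 9" by simp
      define X where "X = nbrs E W x \<union> nbrs E W y"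
      let ?W = "W - X"
      have yx: "x \<in> nbrs E W y" using nsym[OF xy] .
      have xyW: "x \<in> W" "y \<in> W" using xy yx nbrs_subset[of E W x] nbrs_subset[of E W y] by auto
      have "?W \<subset> W" using xy xyW unfolding X_def by blast
      then obtain M where M: "finite M" "M \<subseteq> E" "\<Union>M \<subseteq> ?W" "separated E M"
        "card {v \<in> ?W. nbrs E ?W v \<noteq> {}} \<le> 9 * card M"
        using psubset.IH[of ?W] psubset.prems by blast
      have xyX: "x \<in> X" "y \<in> X" using xy yx unfolding X_def by auto
      have xyE: "{x, y} \<in> E" using yx by (auto simp: nbrs_def split: if_splits)
      have far: "v \<noteq> x" "v \<noteq> y" "{v, x} \<notin> E" "{v, y} \<notin> E" if "e \<in> M" "v \<in> e" for e v
      proof -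
        have "v \<in> W" "v \<notin> X" using that M(3) by auto
        then show "v \<noteq> x" "v \<noteq> y" "{v, x} \<notin> E" "{v, y} \<notin> E"
          using xyX xyW unfolding X_def by (auto simp: nbrs_def)
      qed
      let ?M = "insert {x, y} M"
      have nM: "{x, y} \<notin> M" using far(1) by blast
      have "separated E ?M"
        unfolding separated_def
      proof (intro ballI impI)
        fix e f u v assume h: "e \<in> ?M" "f \<in> ?M" "e \<noteq> f" "u \<in> e" "v \<in> f"
        consider "e \<in> M" "f \<in> M" | "e = {x, y}" "f \<in> M" | "e \<in> M" "f = {x, y}" using h by blast
        then show "u \<noteq> v \<and> {u, v} \<notin> E"
        proof cases
          case 1
          show ?thesis using M(4)[unfolded separated_def, rule_format, OF 1 h(3-5)] .
        next
          case 2 then show ?thesis using far[of f v] h by (auto simp: insert_commute)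
        next
          case 3 then show ?thesis using far[of e u] h by (auto simp: insert_commute)
        qed
      qed
      moreover have "card {v \<in> W. nbrs E W v \<noteq> {}} \<le> 9 * card ?M"
      proof -
        have "{v \<in> W. nbrs E W v \<noteq> {}} \<subseteq> {v \<in> ?W. nbrs E ?W v \<noteq> {}} \<union> (X \<union> iso x y)"
        proof
          fix v assume v: "v \<in> {v \<in> W. nbrs E W v \<noteq> {}}"
          show "v \<in> {v \<in> ?W. nbrs E ?W v \<noteq> {}} \<union> (X \<union> iso x y)"
          proof (cases "v \<in> X \<or> nbrs E ?W v \<noteq> {}")
            case True then show ?thesis using v by blast
          next
            case False
            then have "nbrs E W v \<subseteq> X" using v by (auto simp: nbrs_def)
            then show ?thesis using v False unfolding iso_def X_def by blast
          qed
        qed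
        then have "card {v \<in> W. nbrs E W v \<noteq> {}} \<le> card ({v \<in> ?W. nbrs E ?W v \<noteq> {}} \<union> (X \<union> iso x y))"
          using psubset.hyps finite_iso nfin unfolding X_def by (intro card_mono) auto
        also have "\<dots> \<le> card {v \<in> ?W. nbrs E ?W v \<noteq> {}} + card (X \<union> iso x y)" by (rule card_Un_le)
        also have "card (X \<union> iso x y) \<le> card X + card (iso x y)" by (rule card_Un_le)
        finally show ?thesis using M(1,5) nM small unfolding X_def by simp
      qed
      moreover have "\<Union>?M \<subseteq> W" using M(3) xyW by blast
      ultimately show ?thesis using M(1,2) xyE by (intro exI[of _ ?M]) simp
    qed
  qed
qed

section \<open>Recognising the blown-up five-cycle\<close>

lemma C25_edge_iff:
  assumes "(i, j) \<in> C25_verts" "(i', j') \<in> C25_verts"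
  shows "{(i, j), (i', j')} \<in> C25_edges \<longleftrightarrow> (i' - i) mod 5 = 1 \<or> (i' - i) mod 5 = 4"
proof -
  \<comment> \<open>An unordered pair matches the set comprehension in either order; modulo 5 both
    readings give the same condition.\<close>
  have ex: "{(i, j), (i', j')} \<in> C25_edges \<longleftrightarrow>
      ([i' - i = 1] (mod 5) \<or> [i' - i = -1] (mod 5)) \<or> ([i - i' = 1] (mod 5) \<or> [i - i' = -1] (mod 5))"
    using assms unfolding C25_edges_def by (auto simp: doubleton_eq_iff)
  have "(k mod 5 = 1 mod 5 \<or> k mod 5 = - 1 mod 5) \<or> (- k mod 5 = 1 mod 5 \<or> - k mod 5 = - 1 mod 5)
      \<longleftrightarrow> k mod 5 = 1 \<or> k mod 5 = 4" for k :: int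
    by (auto simp: zmod_zminus1_eq_if)
  from this[of "i' - i"] show ?thesis unfolding ex cong_def minus_diff_eq .
qed

lemma C25_verts_explicit:
  "C25_verts = {(0,1), (0,2), (1,1), (1,2), (2,1), (2,2), (3,1), (3,2), (4,1), (4,2)}"
proof -
  have "{0..<5} = {0, 1, 2, 3, 4 :: int}" by auto
  then show ?thesis unfolding C25_verts_def by auto
qed

lemma all_edges_bad_imp_C25:
  assumes G: "finite_simple_graph V E" and con: "connected_graph V E" and deg: "max_degree V E \<le> 4"
    and W: "W \<subseteq> V" and bad: "all_edges_bad (nbrs E W)" and edge: "nbrs E W w \<noteq> {}"
  shows "graph_isomorphic V E C25_verts C25_edges"
proof -
  interpret all_edges_bad "nbrs E W" using bad .
  interpret whole: subquartic "nbrs E V" using subquartic_nbrs[OF G deg] by simp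
  obtain a where "a \<in> nbrs E W w" using edge by blast
  then obtain w' b b' z z' q q' a' where d: "distinct [w, w', b, b', z, z', q, q', a, a']"
    and N: "nbrs E W w = {a, a', b, b'}" "nbrs E W w' = {a, a', b, b'}"
    "nbrs E W b = {w, w', z, z'}" "nbrs E W b' = {w, w', z, z'}"
    "nbrs E W z = {b, b', q, q'}" "nbrs E W z' = {b, b', q, q'}"
    "nbrs E W q = {z, z', a, a'}" "nbrs E W q' = {z, z', a, a'}"
    "nbrs E W a = {q, q', w, w'}" "nbrs E W a' = {q, q', w, w'}"
    by (rule C25_configuration)
  \<comment> \<open>\<open>distinct\<close> yields each inequality in one orientation; the reversed
    list gives the simplifier the other.\<close>
  have d': "distinct (rev [w, w', b, b', z, z', q, q', a, a'])" using d by (simp only: distinct_rev)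
  define K where "K = {w, w', b, b', z, z', q, q', a, a'}"
  have cl: "nbrs E W v \<subseteq> K \<and> card (nbrs E W v) = 4" if "v \<in> K" for v
    using that d unfolding K_def by (auto simp: N)
  \<comment> \<open>Degree four inside \<open>W\<close> is already the maximum in the whole graph,
    so vertices of \<open>K\<close> gain no neighbours in \<open>V\<close>. Hence \<open>K\<close>
    is closed under adjacency, and connectedness gives \<open>V = K\<close>.\<close>
  have eqV: "nbrs E V v = nbrs E W v" if "v \<in> K" for v
    using card_seteq[OF whole.nfin nbrs_mono[OF W], of v] cl[OF that] whole.ncard[of v] by simp
  have E: "\<And>e. e \<in> E \<Longrightarrow> e \<subseteq> V" using G unfolding finite_simple_graph_def by auto
  have adj: "{u, v} \<in> E \<longleftrightarrow> u \<in> nbrs E V v" if "v \<in> V" for u v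
    using E[of "{u, v}"] that by (auto simp: nbrs_def)
  have KV: "K \<subseteq> V"
  proof
    fix v assume "v \<in> K"
    then have "nbrs E W v \<noteq> {}" using cl[of v] by auto
    then show "v \<in> V" using W by (auto simp: nbrs_def split: if_splits)
  qed
  have VK: "V \<subseteq> K"
  proof
    fix v assume "v \<in> V"
    have "w \<in> K" unfolding K_def by simp
    then have "(w, v) \<in> {(x, y). {x, y} \<in> E}\<^sup>*"
      using con KV \<open>v \<in> V\<close> unfolding connected_graph_def by blast
    then show "v \<in> K"
    proof (induction rule: rtrancl_induct)
      case base then show ?case by (rule \<open>w \<in> K\<close>)
    next
      case (step y x)
      then have "{x, y} \<in> E" by (simp add: insert_commute)
      then have "x \<in> nbrs E V y" using adj KV step.IH by blast
      then show ?case using eqV cl step.IH by blast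
    qed
  qed
  have V: "V = K" using KV VK by blast
  \<comment> \<open>The first coordinate is the position of the twin pair around the five-cycle, the
    second tells the twins apart.\<close>
  define f :: "'a \<Rightarrow> int \<times> nat" where "f x = the (map_of
    [(w, (0,1)), (w', (0,2)), (b, (1,1)), (b', (1,2)), (z, (2,1)), (z', (2,2)),
     (q, (3,1)), (q', (3,2)), (a, (4,1)), (a', (4,2))] x)" for x
  have f: "f w = (0,1)" "f w' = (0,2)" "f b = (1,1)" "f b' = (1,2)" "f z = (2,1)" "f z' = (2,2)"
    "f q = (3,1)" "f q' = (3,2)" "f a = (4,1)" "f a' = (4,2)"
    using d unfolding f_def by auto
  have "f ` K = C25_verts" unfolding K_def C25_verts_explicit by (simp add: f)
  moreover have "inj_on f K" unfolding K_def inj_on_def by (simp add: f)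
  ultimately have bij: "bij_betw f V C25_verts" unfolding V bij_betw_def by blast
  have "{u, v} \<in> E \<longleftrightarrow> {f u, f v} \<in> C25_edges" if u: "u \<in> V" and v: "v \<in> V" for u v
  proof -
    have fm: "f u \<in> C25_verts" "f v \<in> C25_verts" using bij u v by (auto simp: bij_betw_def)
    have "{f u, f v} \<in> C25_edges \<longleftrightarrow> (fst (f v) - fst (f u)) mod 5 = 1 \<or> (fst (f v) - fst (f u)) mod 5 = 4"
      using C25_edge_iff[of "fst (f u)" "snd (f u)" "fst (f v)" "snd (f v)"] fm by simp
    moreover have "{u, v} \<in> E \<longleftrightarrow> u \<in> nbrs E W v" using adj[OF v] eqV v V by simp
    moreover have "u \<in> nbrs E W v \<longleftrightarrow> (fst (f v) - fst (f u)) mod 5 = 1 \<or> (fst (f v) - fst (f u)) mod 5 = 4"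
    proof -
      have "\<forall>v\<in>K. \<forall>u\<in>K. u \<in> nbrs E W v \<longleftrightarrow> (fst (f v) - fst (f u)) mod 5 = 1 \<or> (fst (f v) - fst (f u)) mod 5 = 4"
        unfolding K_def using d d' by (simp add: N f)
      then show ?thesis using u v V by blast
    qed
    ultimately show ?thesis by simp
  qed
  then show ?thesis unfolding graph_isomorphic_def using bij by blast
qed

section \<open>From separated edges to the strong matching number\<close>

theorem theorem1:
  fixes V :: "'a set" and E :: "'a set set"
  assumes "finite_simple_graph V E"
    and "connected_graph V E"
    and "card V \<ge> 2"
    and "max_degree V E \<le> 4"
    and "\<not> graph_isomorphic V E C25_verts C25_edges"
  shows "real (strong_matching_number V E) \<ge> 1 / 9 * real (card V)"
proof -
  have finV: "finite V" and E: "\<And>e. e \<in> E \<Longrightarrow> e \<subseteq> V"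
    using assms(1) unfolding finite_simple_graph_def by auto
  have finE: "finite E" by (rule finite_subset[of _ "Pow V"]) (use E finV in auto)
  have "nbrs E W w = {}" if "W \<subseteq> V" "all_edges_bad (nbrs E W)" for W w
    using all_edges_bad_imp_C25[OF assms(1,2,4) that] assms(5) by blast
  then obtain M where M: "M \<subseteq> E" "separated E M" "card {v \<in> V. nbrs E V v \<noteq> {}} \<le> 9 * card M"
    using separated_matching_exists[OF assms(1,4), of V] by blast
  \<comment> \<open>Connectedness and a second vertex give every vertex an edge, so the non-isolated
    vertices are all of \<open>V\<close>.\<close>
  have "nbrs E V v \<noteq> {}" if v: "v \<in> V" for v
  proof -
    have "\<not> V \<subseteq> {v}" using assms(3) card_mono[of "{v}" V] by auto
    then obtain u where u: "u \<in> V" "u \<noteq> v" by blast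
    then have "(v, u) \<in> {(x, y). {x, y} \<in> E}\<^sup>*" using assms(2) v unfolding connected_graph_def by blast
    then obtain y where "{v, y} \<in> E" using u(2) by (cases rule: converse_rtranclE) auto
    then have "y \<in> nbrs E V v" using E[of "{v, y}"] by (auto simp: nbrs_def insert_commute)
    then show ?thesis by blast
  qed
  then have "{v \<in> V. nbrs E V v \<noteq> {}} = V" by blast
  then have cV: "card V \<le> 9 * card M" using M(3) by simp
  have "induced_matching V E M"
    unfolding induced_matching_def
  proof (intro conjI ballI allI impI)
    show "M \<subseteq> E" by (rule M(1))
    show "card {e \<in> M. v \<in> e} \<le> 1" for v
    proof -
      have "finite {e \<in> M. v \<in> e}" using finite_subset[OF M(1) finE] by simp
      moreover have "e = f" if "e \<in> M" "f \<in> M" "v \<in> e" "v \<in> f" for e f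
        using M(2) that unfolding separated_def by blast
      ultimately have "card {e \<in> M. v \<in> e} \<le> Suc 0" by (subst card_le_Suc0_iff_eq) auto
      then show ?thesis by simp
    qed
    fix a b c d assume h: "{a, b} \<in> M \<and> {c, d} \<in> M \<and> {a, b} \<noteq> {c, d}"
    have "{x, y} \<notin> E" if "x \<in> {a, b}" "y \<in> {c, d}" for x y
      using M(2)[unfolded separated_def, rule_format, OF conjunct1[OF h] conjunct1[OF conjunct2[OF h]]
          conjunct2[OF conjunct2[OF h]] that] by (rule conjunct2)
    then show "{a, c} \<notin> E" "{a, d} \<notin> E" "{b, c} \<notin> E" "{b, d} \<notin> E" by auto
  qed
  moreover have "{M. induced_matching V E M} \<subseteq> Pow E" unfolding induced_matching_def by blast
  then have "finite {M. induced_matching V E M}" by (rule finite_subset) (simp add: finE)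
  ultimately have "card M \<le> strong_matching_number V E"
    unfolding strong_matching_number_def by (intro Max_ge) auto
  then show ?thesis using cV by simp
qed

end
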